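(* Let $m,n\geq 1$ be integers and let $f:X\to Y$ be a quasi-isometry between two connected graphs with bounded degree. The following statements are equivalent: (i) $f$ is quasi-$(m/n)$-to-one; (ii) the map $\iota\circ f\circ\pi: X\times\mathbb{Z}/n\mathbb{Z}\to Y\times\mathbb{Z}/m\mathbb{Z}$ is at bounded distance from a bijection, where $\pi:X\times\mathbb{Z}/n\mathbb{Z}\to X$ is the canonical projection and $\iota:Y\to Y\times\mathbb{Z}/m\mathbb{Z}$ is the canonical embedding; (iii) there exist a partition $\mathcal{P}_X$ of $X$ with uniformly bounded pieces of size $m$, a partition $\mathcal{P}_Y$ of $Y$ with uniformly bounded pieces of size $n$, and a bijection $\psi:\mathcal{P}_X\to\mathcal{P}_Y$, such that $f$ is at bounded distance from a map $g:X\to Y$ satisfying $g(P)\subset\psi(P)$ for every $P\in\mathcal{P}_X$.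
   Context: Graphs are identified with their vertex sets, equipped with the graph (path) metric; a product $Y\times\mathbb{Z}/m\mathbb{Z}$ carries the metric of the product with a finite graph on $\mathbb{Z}/m\mathbb{Z}$, and $\iota$ is $y\mapsto(y,0)$. "Uniformly bounded pieces" means that the diameters of the pieces are bounded by a common constant. Two maps $f,g:X\to Y$ are at bounded distance if $\sup_{x}d(f(x),g(x))<\infty$. For a set $A$ of vertices, $\partial A$ denotes the set of vertices not in $A$ that are adjacent to a vertex of $A$. A map $f:X\to Y$ between metric spaces is a quasi-isometry if there are $C\geq 1$, $K\geq 0$ with $\frac1C d(x,y)-K\leq d(f(x),f(y))\leq C d(x,y)+K$ for all $x,y\in X$ and every point of $Y$ is within distance $K$ of $f(X)$. For $\kappa>0$, a map $f:X\to Y$ between bounded degree graphs is quasi-$\kappa$-to-one if there is a constant $C>0$ such that $\big|\kappa|A|-|f^{-1}(A)|\big|\leq C|\partial A|$ for all finite $A\subset Y$.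
   Formalization: The formal theorem additionally assumes that X is infinite or that m and n are coprime; without this the claim fails, e.g. for X = Y a single point and m = n = 2, where (i) and (ii) hold but (iii) does not. *)

theory Defs
  imports Complex_Main "HOL-Library.Disjoint_Sets"
begin

text \<open>
  A graph is a vertex set together with a symmetric, irreflexive adjacency relation.
  The empty graph counts as connected; allowing it is harmless.
\<close>

definition simple_graph :: "'a set \<Rightarrow> 'a rel \<Rightarrow> bool" where
  "simple_graph V E \<longleftrightarrow> E \<subseteq> V \<times> V \<and> sym E \<and> irrefl E"

definition connected_graph :: "'a set \<Rightarrow> 'a rel \<Rightarrow> bool" where
  "connected_graph V E \<longleftrightarrow> simple_graph V E \<and> (\<forall>x\<in>V. \<forall>y\<in>V. (x, y) \<in> E\<^sup>*)"

definition bounded_degree :: "'a set \<Rightarrow> 'a rel \<Rightarrow> bool" where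
  "bounded_degree V E \<longleftrightarrow> (\<exists>D. \<forall>x\<in>V. finite (E `` {x}) \<and> card (E `` {x}) \<le> D)"

text \<open>
  The path metric: the least length of a walk from one vertex to the other. The value is
  meaningful only for vertices joined by a walk, so it is used for connected graphs only.
\<close>

definition gdist :: "'a rel \<Rightarrow> 'a \<Rightarrow> 'a \<Rightarrow> real" where
  "gdist E x y = real (LEAST k. (x, y) \<in> E ^^ k)"

definition vertex_boundary :: "'a rel \<Rightarrow> 'a set \<Rightarrow> 'a set" where
  "vertex_boundary E A = E `` A - A"

text \<open>Adjacency in the Cartesian (box) product, whose path metric is the sum of the two metrics.\<close>

definition box_product :: "'a set \<Rightarrow> 'a rel \<Rightarrow> 'b set \<Rightarrow> 'b rel \<Rightarrow> ('a \<times> 'b) rel" where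
  "box_product V E W F =
     {((x, i), (y, j)) |x i y j.
        (x, y) \<in> E \<and> i = j \<and> i \<in> W \<or> x = y \<and> x \<in> V \<and> (i, j) \<in> F}"

lemma connected_graph_box_product:
  assumes "connected_graph V E" "connected_graph W F"
  shows "connected_graph (V \<times> W) (box_product V E W F)"
proof -
  let ?B = "box_product V E W F"
  have sub: "E \<subseteq> V \<times> V" "F \<subseteq> W \<times> W" and "sym E" "sym F" "irrefl E" "irrefl F"
    using assms by (auto simp: connected_graph_def simple_graph_def)
  then have "simple_graph (V \<times> W) ?B"
    by (auto simp: simple_graph_def box_product_def sym_def irrefl_def)
  moreover have "((x, i), (y, j)) \<in> ?B\<^sup>*" if "x \<in> V" "i \<in> W" "y \<in> V" "j \<in> W" for x i y j
  proof -
    have "((x, i), (z, i)) \<in> ?B\<^sup>*" if "(x, z) \<in> E\<^sup>*" for z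
      using that
    proof (induction rule: rtrancl_induct)
      case (step u v)
      then have "((u, i), (v, i)) \<in> ?B" using \<open>i \<in> W\<close> by (auto simp: box_product_def)
      with step.IH show ?case by (rule rtrancl_into_rtrancl)
    qed simp
    moreover have "((y, i), (y, k)) \<in> ?B\<^sup>*" if "(i, k) \<in> F\<^sup>*" for k
      using that
    proof (induction rule: rtrancl_induct)
      case (step u v)
      then have "((y, u), (y, v)) \<in> ?B" using \<open>y \<in> V\<close> by (auto simp: box_product_def)
      with step.IH show ?case by (rule rtrancl_into_rtrancl)
    qed simp
    moreover have "(x, y) \<in> E\<^sup>*" "(i, j) \<in> F\<^sup>*"
      using assms that by (auto simp: connected_graph_def)
    ultimately show ?thesis by (blast intro: rtrancl_trans)
  qed
  ultimately show ?thesis by (auto simp: connected_graph_def)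
qed

definition quasi_isometry ::
    "'a set \<Rightarrow> ('a \<Rightarrow> 'a \<Rightarrow> real) \<Rightarrow> 'b set \<Rightarrow> ('b \<Rightarrow> 'b \<Rightarrow> real) \<Rightarrow> ('a \<Rightarrow> 'b) \<Rightarrow> bool" where
  "quasi_isometry X dX Y dY f \<longleftrightarrow>
     f \<in> X \<rightarrow> Y \<and>
     (\<exists>C K. C \<ge> 1 \<and> K \<ge> 0 \<and>
        (\<forall>x\<in>X. \<forall>y\<in>X. 1 / C * dX x y - K \<le> dY (f x) (f y) \<and> dY (f x) (f y) \<le> C * dX x y + K) \<and>
        (\<forall>y\<in>Y. \<exists>x\<in>X. dY y (f x) \<le> K))"

definition at_bounded_distance :: "'a set \<Rightarrow> ('b \<Rightarrow> 'b \<Rightarrow> real) \<Rightarrow> ('a \<Rightarrow> 'b) \<Rightarrow> ('a \<Rightarrow> 'b) \<Rightarrow> bool" where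
  "at_bounded_distance X d f g \<longleftrightarrow> bdd_above ((\<lambda>x. d (f x) (g x)) ` X)"

text \<open>
  The finiteness conjunct is implicit in the inequality on paper; it has to be spelled out
  because \<open>card\<close> is zero on infinite sets.
\<close>

definition quasi_to_one :: "real \<Rightarrow> 'a set \<Rightarrow> 'b set \<Rightarrow> 'b rel \<Rightarrow> ('a \<Rightarrow> 'b) \<Rightarrow> bool" where
  "quasi_to_one \<kappa> X Y E f \<longleftrightarrow>
     (\<exists>C>0. \<forall>A. finite A \<and> A \<subseteq> Y \<longrightarrow>
        finite (f -` A \<inter> X) \<and>
        \<bar>\<kappa> * real (card A) - real (card (f -` A \<inter> X))\<bar> \<le> C * real (card (vertex_boundary E A)))"

definition uniformly_bounded :: "('a \<Rightarrow> 'a \<Rightarrow> real) \<Rightarrow> 'a set set \<Rightarrow> bool" where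
  "uniformly_bounded d \<P> \<longleftrightarrow> (\<exists>D. \<forall>P\<in>\<P>. \<forall>x\<in>P. \<forall>y\<in>P. d x y \<le> D)"

end

theory Submission imports Defs begin

text \<open>
  The three conditions are proved equivalent in a cycle. Throughout, boundedness is expressed by
  the relation \<open>near E k\<close> (joined by a walk of length at most \<open>k\<close>), and
  \<open>thicken E k A\<close> is the \<open>k\<close>-neighbourhood of \<open>A\<close>.
  
  (ii) implies (i): a bijection \<open>h\<close> that moves points by at most \<open>k\<close> can only take the fibre over
  \<open>A\<close> out of \<open>A\<close>, or fail to cover \<open>A\<close>, within distance \<open>k\<close> of the boundary of \<open>A\<close>, because a walk
  leaving \<open>A\<close> passes through the boundary. In a graph of bounded degree this exceptional set has
  size at most a constant times the size of the boundary.
  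
  (i) implies (iii): partition \<open>Y\<close> into bounded pieces of size \<open>n\<close>, and look for a perfect matching
  between \<open>X\<close> and \<open>m\<close> copies of the set of pieces, where \<open>x\<close> may be matched with a piece within
  distance \<open>R\<close> of \<open>f x\<close>. The fibres of the matching are the pieces of \<open>X\<close>; they are bounded since
  \<open>f\<close> is a quasi-isometry. Three ingredients are needed.
  
  \<^item> Hall's theorem for infinite families of finite sets, together with the Schroeder--Bernstein
  construction, which combines a matching of either side into a perfect one (\<open>perfect_matching\<close>).
  
  \<^item> The Hall inequalities, that is, for a suitable \<open>R\<close> and every finite \<open>B\<close>, the fibre over \<open>B\<close>
  has at most \<open>m/n\<close> times the size of the \<open>R\<close>-neighbourhood of \<open>B\<close>, and \<open>B\<close> has at most \<open>n/m\<close> times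
  the size of the fibre over its \<open>R\<close>-neighbourhood (\<open>quasi_to_one_imp_thickened_bounds\<close>). The
  quasi-\<open>m/n\<close>-to-one inequality applied to \<open>B\<close> itself is of no use, as the boundary of \<open>B\<close> may be
  much larger than the number of points gained by thickening; it is applied to the
  \<open>k\<close>-neighbourhood of \<open>B\<close>, for a \<open>k\<close> at which the boundary is smallest. This boundary is outweighed
  by the other layers around \<open>B\<close>, and those make up for the error term.
  
  \<^item> The partition of \<open>Y\<close>. In an infinite graph it is found by sending leftover points towards
  infinity along a spanning tree (\<open>infinite_graph_equipartition\<close>). If \<open>X\<close> is finite then (i), applied
  to the whole of \<open>Y\<close>, says that \<open>m\<close> times the size of \<open>Y\<close> equals \<open>n\<close> times the size of \<open>X\<close>, and
  coprimality makes the size of \<open>Y\<close> divisible by \<open>n\<close>.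
  
  (iii) implies (ii): for a piece \<open>P\<close> of \<open>X\<close>, both \<open>n\<close> copies of \<open>P\<close> and \<open>m\<close> copies of \<open>\<psi> P\<close> have
  \<open>m * n\<close> elements, and any bijections between them fit together.
\<close>

section \<open>Hall's theorem and perfect matchings\<close>

definition hall_condition :: "'a set \<Rightarrow> ('a \<times> 'b) set \<Rightarrow> bool" where
  "hall_condition I r \<longleftrightarrow> (\<forall>J. finite J \<and> J \<subseteq> I \<longrightarrow> card J \<le> card (r `` J))"

text \<open>
  This is the submodularity step in Rado's proof of Hall's theorem. If both removals failed, they
  would fail on sets \<open>J\<^sub>a\<close> and \<open>J\<^sub>b\<close> that contain \<open>i\<close>; the union of their two neighbourhoods contains
  the full neighbourhood of the union of \<open>J\<^sub>a\<close> and \<open>J\<^sub>b\<close>, as \<open>a\<close> and \<open>b\<close> are each lost on one side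
  only, and the Hall condition for the union and for the intersection without \<open>i\<close> gives a count that
  is too large by one.
\<close>
lemma hall_condition_remove_edge:
  assumes fin: "\<And>i. i \<in> I \<Longrightarrow> finite (r `` {i})" and hall: "hall_condition I r"
    and "i \<in> I" and a: "(i, a) \<in> r" and b: "(i, b) \<in> r" and "a \<noteq> b"
  shows "hall_condition I (r - {(i, a)}) \<or> hall_condition I (r - {(i, b)})"
proof (rule ccontr)
  assume neg: "\<not> ?thesis"
  obtain J\<^sub>a where Ja: "finite J\<^sub>a" "J\<^sub>a \<subseteq> I" "card ((r - {(i, a)}) `` J\<^sub>a) < card J\<^sub>a"
    using neg by (auto simp: hall_condition_def not_le)
  obtain J\<^sub>b where Jb: "finite J\<^sub>b" "J\<^sub>b \<subseteq> I" "card ((r - {(i, b)}) `` J\<^sub>b) < card J\<^sub>b"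
    using neg by (auto simp: hall_condition_def not_le)
  have fin_im: "finite (r `` J)" if "finite J" "J \<subseteq> I" for J
    using fin that by (subst Image_eq_UN) blast
  have i_mem: "i \<in> J" if "finite J" "J \<subseteq> I" "card ((r - {(i, c)}) `` J) < card J" for c J
  proof (rule ccontr)
    assume "i \<notin> J"
    then have "(r - {(i, c)}) `` J = r `` J" by blast
    then show False using hall that unfolding hall_condition_def by (metis not_le)
  qed
  have ia: "i \<in> J\<^sub>a" and ib: "i \<in> J\<^sub>b" using i_mem Ja Jb by blast+
  define P where "P = (r - {(i, a)}) `` J\<^sub>a"
  define Q where "Q = (r - {(i, b)}) `` J\<^sub>b"
  have finP: "finite P" and finQ: "finite Q"
    unfolding P_def Q_def
    by (rule finite_subset[OF _ fin_im[OF Ja(1,2)]], blast)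
      (rule finite_subset[OF _ fin_im[OF Jb(1,2)]], blast)
  have "r `` (J\<^sub>a \<union> J\<^sub>b) \<subseteq> P \<union> Q"
    using a b ia ib \<open>a \<noteq> b\<close> unfolding P_def Q_def by blast
  then have "card (r `` (J\<^sub>a \<union> J\<^sub>b)) \<le> card (P \<union> Q)"
    using finP finQ by (intro card_mono) auto
  moreover have "card (J\<^sub>a \<union> J\<^sub>b) \<le> card (r `` (J\<^sub>a \<union> J\<^sub>b))"
    using hall Ja Jb by (auto simp: hall_condition_def)
  moreover have "r `` (J\<^sub>a \<inter> J\<^sub>b - {i}) \<subseteq> P \<inter> Q"
    unfolding P_def Q_def by blast
  then have "card (r `` (J\<^sub>a \<inter> J\<^sub>b - {i})) \<le> card (P \<inter> Q)"
    using finP by (intro card_mono) auto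
  moreover have "card (J\<^sub>a \<inter> J\<^sub>b - {i}) \<le> card (r `` (J\<^sub>a \<inter> J\<^sub>b - {i}))"
    using hall Ja Jb unfolding hall_condition_def by blast
  moreover have "card (J\<^sub>a \<inter> J\<^sub>b - {i}) + 1 = card (J\<^sub>a \<inter> J\<^sub>b)"
    using ia ib Ja(1) by (subst card_Suc_Diff1[symmetric, of _ i]) auto
  moreover have "card P + card Q = card (P \<union> Q) + card (P \<inter> Q)"
    using finP finQ by (rule card_Un_Int)
  moreover have "card J\<^sub>a + card J\<^sub>b = card (J\<^sub>a \<union> J\<^sub>b) + card (J\<^sub>a \<inter> J\<^sub>b)"
    using Ja(1) Jb(1) by (rule card_Un_Int)
  moreover have "card P < card J\<^sub>a" "card Q < card J\<^sub>b"
    using Ja(3) Jb(3) by (simp_all add: P_def Q_def)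
  ultimately show False by linarith
qed

text \<open>
  By Zorn's lemma there is a maximal set of edges whose removal preserves the Hall condition: for a
  union of a chain, the condition on a finite \<open>J\<close> depends on the finitely many edges at \<open>J\<close>, which are
  treated by the union as by one member of the chain. After a maximal removal every \<open>i\<close> has one edge
  left, by the previous lemma, and the Hall condition on pairs makes the resulting map injective.
\<close>
theorem hall_infinite:
  assumes fin: "\<And>i. i \<in> I \<Longrightarrow> finite (r `` {i})" and hall: "hall_condition I r"
  shows "\<exists>f. inj_on f I \<and> (\<forall>i\<in>I. (i, f i) \<in> r)"
proof -
  define \<A> where "\<A> = {D. D \<subseteq> r \<and> hall_condition I (r - D)}"
  have "\<exists>M\<in>\<A>. \<forall>D\<in>\<A>. M \<subseteq> D \<longrightarrow> D = M"
  proof (rule subset_Zorn_nonempty)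
    show "\<A> \<noteq> {}" using hall by (auto simp: \<A>_def intro!: exI[of _ "{}"])
  next
    fix \<C> assume ne: "\<C> \<noteq> {}" and chain: "subset.chain \<A> \<C>"
    then have sub: "\<C> \<subseteq> \<A>" by (simp add: subset_chain_def)
    have "card J \<le> card ((r - \<Union>\<C>) `` J)" if J: "finite J" "J \<subseteq> I" for J
    proof -
      have fJ: "finite (r `` J)"
        using fin J by (subst Image_eq_UN) blast
      then have "finite (J \<times> r `` J)" using J by blast
      then have "finite ((J \<times> r `` J) \<inter> \<Union>\<C>)" by blast
      then obtain D where D: "D \<in> \<C>" "(J \<times> r `` J) \<inter> \<Union>\<C> \<subseteq> D"
        using finite_subset_Union_chain[OF _ _ ne chain] by blast
      then have "(r - D) `` J \<subseteq> (r - \<Union>\<C>) `` J" by blast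
      moreover have "(r - \<Union>\<C>) `` J \<subseteq> r `` J" by blast
      ultimately have "card ((r - D) `` J) \<le> card ((r - \<Union>\<C>) `` J)"
        using fJ by (meson card_mono finite_subset)
      moreover have "card J \<le> card ((r - D) `` J)"
        using D sub J by (auto simp: \<A>_def hall_condition_def)
      ultimately show ?thesis by linarith
    qed
    then show "\<Union>\<C> \<in> \<A>"
      using sub by (auto simp: \<A>_def hall_condition_def)
  qed
  then obtain M where "M \<in> \<A>" and max: "\<And>D. D \<in> \<A> \<Longrightarrow> M \<subseteq> D \<Longrightarrow> D = M"
    by auto
  then have M: "M \<subseteq> r" "hall_condition I (r - M)" by (simp_all add: \<A>_def)
  define q where "q = r - M"
  have hq: "hall_condition I q" using M by (simp add: q_def)
  \<comment> \<open>Of two edges at \<open>i\<close>, one could still be removed.\<close>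
  have uniq: "a = b" if e: "i \<in> I" "(i, a) \<in> q" "(i, b) \<in> q" for i a b
  proof (rule ccontr)
    assume "a \<noteq> b"
    moreover have "finite (q `` {j})" if "j \<in> I" for j
      by (rule finite_subset[OF _ fin[OF that]]) (auto simp: q_def)
    ultimately have "hall_condition I (q - {(i, a)}) \<or> hall_condition I (q - {(i, b)})"
      using hall_condition_remove_edge[of I q i a b] hq e by blast
    then obtain c where c: "(i, c) \<in> q" "hall_condition I (q - {(i, c)})"
      using e by blast
    have "r - insert (i, c) M = q - {(i, c)}" by (auto simp: q_def)
    then have "insert (i, c) M \<in> \<A>" using c M by (auto simp: \<A>_def q_def)
    then have "insert (i, c) M = M" using max by blast
    then show False using c by (auto simp: q_def)
  qed
  have ex: "\<exists>a. (i, a) \<in> q" if "i \<in> I" for i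
  proof (rule ccontr)
    assume "\<not> ?thesis"
    then have "q `` {i} = {}" by blast
    moreover have "card {i} \<le> card (q `` {i})"
      using hq that unfolding hall_condition_def by blast
    ultimately show False by simp
  qed
  obtain f where f: "\<And>i. i \<in> I \<Longrightarrow> (i, f i) \<in> q" using ex by metis
  have "inj_on f I"
  proof (rule inj_onI, rule ccontr)
    fix i j assume ij: "i \<in> I" "j \<in> I" "f i = f j" "i \<noteq> j"
    have "q `` {k} = {f k}" if "k \<in> I" for k using f[OF that] uniq[OF that] by blast
    then have "q `` {i, j} = {f i}" using ij Image_Un[of q "{i}" "{j}"] by (simp add: insert_commute)
    moreover have "card {i, j} \<le> card (q `` {i, j})"
      using hq[unfolded hall_condition_def, rule_format, of "{i, j}"] ij(1,2) by simp
    ultimately show False using ij by simp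
  qed
  then show ?thesis using f by (auto simp: q_def)
qed

text \<open>
  The cardinality statement would not do here: a bijection at bounded distance is wanted, so every
  pair of the bijection must come from \<open>f\<close> or from \<open>g\<close>.
\<close>
lemma Schroeder_Bernstein_along:
  assumes f: "inj_on f A" "f ` A \<subseteq> B" and g: "inj_on g B" "g ` B \<subseteq> A"
  shows "\<exists>h. bij_betw h A B \<and> (\<forall>a\<in>A. h a = f a \<or> g (h a) = a)"
proof -
  define C where "C = lfp (\<lambda>C. A - g ` (B - f ` C))"
  have "mono (\<lambda>C. A - g ` (B - f ` C))" by (rule monoI) blast
  then have C: "C = A - g ` (B - f ` C)" unfolding C_def by (rule lfp_unfold)
  define h where "h a = (if a \<in> C then f a else inv_into B g a)" for a
  have CA: "C \<subseteq> A" using C by blast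
  have AC: "A - C = g ` (B - f ` C)" using C g by blast
  have "bij_betw h C (f ` C)"
    using inj_on_subset[OF f(1) CA] by (auto simp: bij_betw_def h_def inj_on_def)
  moreover have "bij_betw h (A - C) (B - f ` C)"
  proof (rule bij_betw_byWitness[where f' = g])
    show "\<forall>a\<in>A - C. g (h a) = a"
      using AC by (auto simp: h_def f_inv_into_f)
    show "\<forall>b\<in>B - f ` C. h (g b) = b" using AC g by (auto simp: h_def)
    show "h ` (A - C) \<subseteq> B - f ` C" using AC g by (auto simp: h_def)
    show "g ` (B - f ` C) \<subseteq> A - C" using AC by blast
  qed
  ultimately have "bij_betw h (C \<union> (A - C)) (f ` C \<union> (B - f ` C))"
    by (rule bij_betw_combine) blast
  moreover have "C \<union> (A - C) = A" "f ` C \<union> (B - f ` C) = B" using CA f by blast+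
  moreover have "h a = f a \<or> g (h a) = a" if "a \<in> A" for a
  proof (cases "a \<in> C")
    case False
    then have "a \<in> g ` B" using that AC by blast
    then show ?thesis using False by (simp add: h_def f_inv_into_f)
  qed (simp add: h_def)
  ultimately show ?thesis by metis
qed

theorem perfect_matching:
  assumes "r \<subseteq> A \<times> B"
    and "\<And>a. a \<in> A \<Longrightarrow> finite (r `` {a})" and "\<And>b. b \<in> B \<Longrightarrow> finite (r\<inverse> `` {b})"
    and "hall_condition A r" and "hall_condition B (r\<inverse>)"
  shows "\<exists>h. bij_betw h A B \<and> (\<forall>a\<in>A. (a, h a) \<in> r)"
proof -
  obtain f where f: "inj_on f A" "\<And>a. a \<in> A \<Longrightarrow> (a, f a) \<in> r"
    using hall_infinite[of A r] assms by blast
  obtain g where g: "inj_on g B" "\<And>b. b \<in> B \<Longrightarrow> (g b, b) \<in> r"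
    using hall_infinite[of B "r\<inverse>"] assms by (metis converse_iff)
  have "f ` A \<subseteq> B" "g ` B \<subseteq> A" using f g assms(1) by blast+
  then obtain h where h: "bij_betw h A B" "\<And>a. a \<in> A \<Longrightarrow> h a = f a \<or> g (h a) = a"
    using Schroeder_Bernstein_along[of f A B g] f g by blast
  have "(a, h a) \<in> r" if "a \<in> A" for a
    using h(2)[OF that] f(2)[OF that] g(2)[of "h a"] bij_betwE[OF h(1)] that by force
  then show ?thesis using h by blast
qed

section \<open>Walks of bounded length\<close>

text \<open>
  The reflexive closure turns walks of length exactly \<open>k\<close> into walks of length at most \<open>k\<close>, so that
  the relations increase with \<open>k\<close> and describe the balls of the path metric.
\<close>
abbreviation near :: "'a rel \<Rightarrow> nat \<Rightarrow> 'a rel" where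
  "near E k \<equiv> (E\<^sup>=) ^^ k"

lemma near_refl [simp]: "(x, x) \<in> near E k"
proof (induction k)
  case (Suc k)
  then show ?case by (rule relpow_Suc_I) simp
qed simp

lemma near_mono: "i \<le> j \<Longrightarrow> (x, y) \<in> near E i \<Longrightarrow> (x, y) \<in> near E j"
  using relpow_trans[of x y i "E\<^sup>=" y "j - i"] by simp

lemma near_sym:
  assumes "sym E" "(x, y) \<in> near E k"
  shows "(y, x) \<in> near E k"
  using assms(2)
proof (induction k arbitrary: y)
  case (Suc k)
  then obtain z where "(x, z) \<in> near E k" "(z, y) \<in> E\<^sup>=" by (rule_tac relpow_Suc_E)
  then have "(z, x) \<in> near E k" "(y, z) \<in> E\<^sup>=" using Suc.IH assms(1) by (auto dest: symD)
  then show ?case by (rule_tac relpow_Suc_I2)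
qed simp

lemma near_iff_walk: "(x, y) \<in> near E k \<longleftrightarrow> (\<exists>j\<le>k. (x, y) \<in> E ^^ j)"
proof
  assume "(x, y) \<in> near E k"
  then show "\<exists>j\<le>k. (x, y) \<in> E ^^ j"
  proof (induction k arbitrary: y)
    case (Suc k)
    then obtain z where "(x, z) \<in> near E k" and z: "(z, y) \<in> E\<^sup>=" by (rule_tac relpow_Suc_E)
    then obtain j where "j \<le> k" "(x, z) \<in> E ^^ j" using Suc.IH by blast
    then show ?case
      using z by (cases "z = y") (auto intro: relpow_Suc_I exI[of _ "Suc j"] exI[of _ j])
  qed auto
next
  have "(x, y) \<in> near E j" if "(x, y) \<in> E ^^ j" for j
    using that by (induction j arbitrary: y) auto
  then show "\<exists>j\<le>k. (x, y) \<in> E ^^ j \<Longrightarrow> (x, y) \<in> near E k"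
    using near_mono by metis
qed

lemma near_closed:
  assumes "E \<subseteq> V \<times> V" "(x, y) \<in> near E k" "x \<in> V"
  shows "y \<in> V"
  using assms(2)
proof (induction k arbitrary: y)
  case (Suc k)
  then obtain z where "(x, z) \<in> near E k" "(z, y) \<in> E\<^sup>=" by (rule_tac relpow_Suc_E)
  then show ?case using Suc.IH assms(1) by blast
qed (use assms(3) in simp)

lemma gdist_le_iff:
  assumes "connected_graph V E" "x \<in> V" "y \<in> V"
  shows "gdist E x y \<le> real k \<longleftrightarrow> (x, y) \<in> near E k"
proof -
  have "(x, y) \<in> E\<^sup>*" using assms by (auto simp: connected_graph_def)
  then obtain j where "(x, y) \<in> E ^^ j" using rtrancl_imp_relpow by blast
  then have "(x, y) \<in> E ^^ (LEAST k. (x, y) \<in> E ^^ k)" by (rule LeastI)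
  then show ?thesis
    unfolding gdist_def near_iff_walk by (auto intro: Least_le order_trans)
qed

lemma gdist_le_imp_near:
  assumes "connected_graph V E" "x \<in> V" "y \<in> V" "gdist E x y \<le> c"
  shows "(x, y) \<in> near E (nat \<lceil>c\<rceil>)"
  using gdist_le_iff[OF assms(1-3)] assms(4) by (meson order_trans real_nat_ceiling_ge)

lemma at_bounded_distance_iff:
  assumes "connected_graph V E" and f: "f \<in> X \<rightarrow> V" and g: "g \<in> X \<rightarrow> V"
  shows "at_bounded_distance X (gdist E) f g \<longleftrightarrow> (\<exists>k. \<forall>x\<in>X. (f x, g x) \<in> near E k)"
proof
  assume "at_bounded_distance X (gdist E) f g"
  then obtain c where "\<forall>x\<in>X. gdist E (f x) (g x) \<le> c"
    by (auto simp: at_bounded_distance_def bdd_above_def)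
  then show "\<exists>k. \<forall>x\<in>X. (f x, g x) \<in> near E k"
    using gdist_le_imp_near[OF assms(1)] f g by (meson PiE)
next
  assume "\<exists>k. \<forall>x\<in>X. (f x, g x) \<in> near E k"
  then obtain k where "\<forall>x\<in>X. gdist E (f x) (g x) \<le> real k"
    using gdist_le_iff[OF assms(1)] f g by (meson PiE)
  then show "at_bounded_distance X (gdist E) f g"
    by (auto simp: at_bounded_distance_def bdd_above_def)
qed

lemma uniformly_bounded_iff:
  assumes "connected_graph V E" and "\<And>P. P \<in> \<P> \<Longrightarrow> P \<subseteq> V"
  shows "uniformly_bounded (gdist E) \<P> \<longleftrightarrow> (\<exists>k. \<forall>P\<in>\<P>. P \<times> P \<subseteq> near E k)"
proof
  assume "uniformly_bounded (gdist E) \<P>"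
  then obtain c where c: "\<And>P x y. P \<in> \<P> \<Longrightarrow> x \<in> P \<Longrightarrow> y \<in> P \<Longrightarrow> gdist E x y \<le> c"
    unfolding uniformly_bounded_def by blast
  have "P \<times> P \<subseteq> near E (nat \<lceil>c\<rceil>)" if "P \<in> \<P>" for P
    using c[OF that] gdist_le_imp_near[OF assms(1)] assms(2)[OF that] by blast
  then show "\<exists>k. \<forall>P\<in>\<P>. P \<times> P \<subseteq> near E k" by blast
next
  assume "\<exists>k. \<forall>P\<in>\<P>. P \<times> P \<subseteq> near E k"
  then obtain k where k: "\<And>P. P \<in> \<P> \<Longrightarrow> P \<times> P \<subseteq> near E k" by blast
  have "gdist E x y \<le> real k" if "P \<in> \<P>" "x \<in> P" "y \<in> P" for P x y
    using k[OF that(1)] gdist_le_iff[OF assms(1)] assms(2)[OF that(1)] that by blast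
  then show "uniformly_bounded (gdist E) \<P>" unfolding uniformly_bounded_def by blast
qed

lemma finite_connected_graph_bounded:
  assumes "connected_graph V E" "finite V"
  shows "\<exists>k. V \<times> V \<subseteq> near E k"
proof -
  define c where "c = Max ((\<lambda>(x, y). gdist E x y) ` (V \<times> V))"
  have "gdist E x y \<le> c" if "x \<in> V" "y \<in> V" for x y
    unfolding c_def using that assms(2) by (intro Max_ge) auto
  then show ?thesis using gdist_le_imp_near[OF assms(1)] by blast
qed

lemma box_product_near_fst:
  assumes "(p, q) \<in> near (box_product V E W F) k"
  shows "(fst p, fst q) \<in> near E k"
  using assms
proof (induction k arbitrary: q)
  case (Suc k)
  then obtain z where "(p, z) \<in> near (box_product V E W F) k"
    and z: "(z, q) \<in> (box_product V E W F)\<^sup>=" by (rule_tac relpow_Suc_E)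
  then have "(fst p, fst z) \<in> near E k" using Suc.IH by blast
  moreover have "(fst z, fst q) \<in> E\<^sup>=" using z by (auto simp: box_product_def)
  ultimately show ?case by (rule relpow_Suc_I)
qed simp

text \<open>
  Walk from \<open>y\<close> to \<open>z\<close> in the layer of \<open>i\<close>, and then from \<open>i\<close> to \<open>j\<close> over \<open>z\<close>.
\<close>
lemma box_product_near:
  assumes "(y, z) \<in> near E k" "(i, j) \<in> near F l" "z \<in> V" "i \<in> W"
  shows "((y, i), (z, j)) \<in> near (box_product V E W F) (k + l)"
proof (rule relpow_trans)
  show "((y, i), (z, i)) \<in> near (box_product V E W F) k"
    using assms(1)
  proof (induction k arbitrary: z)
    case (Suc k)
    then obtain w where "(y, w) \<in> near E k" and w: "(w, z) \<in> E\<^sup>=" by (rule_tac relpow_Suc_E)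
    then have "((y, i), (w, i)) \<in> near (box_product V E W F) k" using Suc.IH by blast
    moreover have "((w, i), (z, i)) \<in> (box_product V E W F)\<^sup>="
      using w \<open>i \<in> W\<close> by (auto simp: box_product_def)
    ultimately show ?case by (rule relpow_Suc_I)
  qed simp
  show "((z, i), (z, j)) \<in> near (box_product V E W F) l"
    using assms(2)
  proof (induction l arbitrary: j)
    case (Suc l)
    then obtain w where "(i, w) \<in> near F l" and w: "(w, j) \<in> F\<^sup>=" by (rule_tac relpow_Suc_E)
    then have "((z, i), (z, w)) \<in> near (box_product V E W F) l" using Suc.IH by blast
    moreover have "((z, w), (z, j)) \<in> (box_product V E W F)\<^sup>="
      using w \<open>z \<in> V\<close> by (auto simp: box_product_def)
    ultimately show ?case by (rule relpow_Suc_I)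
  qed simp
qed

section \<open>Neighbourhoods of finite sets\<close>

definition thicken :: "'a rel \<Rightarrow> nat \<Rightarrow> 'a set \<Rightarrow> 'a set" where
  "thicken E k A = near E k `` A"

lemma in_thicken_iff: "y \<in> thicken E k A \<longleftrightarrow> (\<exists>x\<in>A. (x, y) \<in> near E k)"
  by (auto simp: thicken_def)

lemma thicken_0 [simp]: "thicken E 0 A = A"
  by (auto simp: thicken_def)

lemma thicken_Suc: "thicken E (Suc k) A = thicken E k A \<union> vertex_boundary E (thicken E k A)"
  by (auto simp: thicken_def vertex_boundary_def)

lemma thicken_mono: "i \<le> j \<Longrightarrow> thicken E i A \<subseteq> thicken E j A"
  unfolding in_thicken_iff subset_iff by (meson near_mono)

lemma subset_thicken: "A \<subseteq> thicken E k A"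
  using thicken_mono[of 0 k E A] by simp

lemma thicken_closed: "E \<subseteq> V \<times> V \<Longrightarrow> A \<subseteq> V \<Longrightarrow> thicken E k A \<subseteq> V"
proof
  fix y assume "E \<subseteq> V \<times> V" "A \<subseteq> V" "y \<in> thicken E k A"
  then show "y \<in> V" using near_closed[of E V _ y k] by (auto simp: in_thicken_iff)
qed

lemma thicken_thicken: "thicken E i (thicken E j A) = thicken E (j + i) A"
  by (auto simp: thicken_def relpow_add)

lemma card_Image_le:
  assumes "finite A" "\<And>x. x \<in> A \<Longrightarrow> finite (r `` {x}) \<and> card (r `` {x}) \<le> D"
  shows "finite (r `` A) \<and> card (r `` A) \<le> D * card A"
proof -
  have "card (\<Union>x\<in>A. r `` {x}) \<le> (\<Sum>x\<in>A. card (r `` {x}))"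
    using assms(1) by (rule card_UN_le)
  also have "\<dots> \<le> of_nat (card A) * D" using assms by (intro sum_bounded_above) auto
  finally show ?thesis using assms by (subst (1 2) Image_eq_UN) (auto simp: mult.commute)
qed

lemma card_thicken_le:
  assumes "E \<subseteq> V \<times> V" and deg: "\<forall>x\<in>V. finite (E `` {x}) \<and> card (E `` {x}) \<le> D"
    and "finite A" "A \<subseteq> V"
  shows "finite (thicken E k A) \<and> card (thicken E k A) \<le> (D + 1) ^ k * card A"
proof (induction k)
  case (Suc k)
  let ?T = "thicken E k A"
  have "?T \<subseteq> V" using thicken_closed assms by blast
  then have "finite (E `` ?T) \<and> card (E `` ?T) \<le> D * card ?T"
    using deg Suc by (intro card_Image_le) auto
  moreover have "thicken E (Suc k) A = ?T \<union> E `` ?T" by (auto simp: thicken_def)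
  moreover have "card (?T \<union> E `` ?T) \<le> card ?T + card (E `` ?T)" by (rule card_Un_le)
  moreover have "(D + 1) * card ?T \<le> (D + 1) * ((D + 1) ^ k * card A)"
    using Suc by (intro mult_le_mono2) blast
  ultimately show ?case using Suc by (auto simp: algebra_simps)
qed (use assms in simp)

text \<open>
  The first vertex outside \<open>A\<close> on a walk that leaves \<open>A\<close> lies in the boundary of \<open>A\<close>, and it splits
  the walk in two.
\<close>
lemma near_crosses_boundary:
  assumes "(a, b) \<in> near E k" "a \<in> A" "b \<notin> A"
  shows "\<exists>c\<in>vertex_boundary E A. (a, c) \<in> near E k \<and> (c, b) \<in> near E k"
  using assms(1,3)
proof (induction k arbitrary: b)
  case 0
  then have "a = b" by simp
  then show ?case using 0 assms(2) by blast
next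
  case (Suc k)
  obtain z where z: "(a, z) \<in> near E k" "(z, b) \<in> E\<^sup>=" by (rule relpow_Suc_E[OF Suc.prems(1)])
  show ?case
  proof (cases "z \<in> A")
    case True
    then have "b \<in> vertex_boundary E A" using z Suc.prems by (auto simp: vertex_boundary_def)
    then show ?thesis using Suc.prems(1) near_refl[of b "Suc k"] by blast
  next
    case False
    then obtain c where "c \<in> vertex_boundary E A" "(a, c) \<in> near E k" "(c, z) \<in> near E k"
      using Suc.IH[OF z(1) False] by blast
    moreover from this have "(a, c) \<in> near E (Suc k)" "(c, b) \<in> near E (Suc k)"
      using near_mono[of k "Suc k" a c] z(2) by (simp, blast intro: relpow_Suc_I)
    ultimately show ?thesis by blast
  qed
qed

section \<open>Bijections at bounded distance are quasi-to-one\<close>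

text \<open>
  With \<open>B\<close> the \<open>k\<close>-neighbourhood of the boundary of \<open>A\<close>, the map \<open>h\<close> sends the fibre over \<open>A\<close> into
  \<open>A \<union> B\<close> and covers \<open>A - B\<close>. Hence the two cardinalities differ by at most that of \<open>B\<close>.
\<close>
theorem bijection_imp_quasi_to_one:
  fixes m n :: nat
  assumes E: "E \<subseteq> Y \<times> Y" "sym E" and deg: "\<forall>y\<in>Y. finite (E `` {y}) \<and> card (E `` {y}) \<le> D"
    and mn: "m \<ge> 1" "n \<ge> 1"
    and h: "bij_betw h (X \<times> {..<n}) (Y \<times> {..<m})"
    and close: "\<And>x i. x \<in> X \<Longrightarrow> i < n \<Longrightarrow> (f x, fst (h (x, i))) \<in> near E k"
  shows "quasi_to_one (real m / real n) X Y E f"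
proof -
  have "finite (f -` A \<inter> X) \<and>
      \<bar>real m / real n * real (card A) - real (card (f -` A \<inter> X))\<bar>
        \<le> real (m * (D + 1) ^ k) * real (card (vertex_boundary E A))"
    if A: "finite A" "A \<subseteq> Y" for A
  proof -
    define S where "S = f -` A \<inter> X"
    define B where "B = thicken E k (vertex_boundary E A)"
    have "vertex_boundary E A \<subseteq> Y" using E by (auto simp: vertex_boundary_def)
    moreover have "finite (vertex_boundary E A)"
      using card_Image_le[of A E D] A deg by (auto simp: vertex_boundary_def)
    ultimately have B: "finite B" "card B \<le> (D + 1) ^ k * card (vertex_boundary E A)"
      using card_thicken_le[OF E(1) deg] unfolding B_def by blast+
    have inj: "inj_on h (S \<times> {..<n})"
      using h by (rule inj_on_subset[OF bij_betw_imp_inj_on]) (auto simp: S_def)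
    have sub1: "h ` (S \<times> {..<n}) \<subseteq> (A \<union> B) \<times> {..<m}"
    proof
      fix p assume "p \<in> h ` (S \<times> {..<n})"
      then obtain x i where p: "p = h (x, i)" "x \<in> X" "f x \<in> A" "i < n" by (auto simp: S_def)
      have "fst p \<in> B" if "fst p \<notin> A"
        using near_crosses_boundary[OF close[OF p(2,4)] p(3)] that p(1)
        by (auto simp: B_def in_thicken_iff)
      moreover have "p \<in> Y \<times> {..<m}" using bij_betwE[OF h] p by blast
      ultimately show "p \<in> (A \<union> B) \<times> {..<m}" by (cases p) auto
    qed
    have sub2: "(A - B) \<times> {..<m} \<subseteq> h ` (S \<times> {..<n})"
    proof
      fix p assume p: "p \<in> (A - B) \<times> {..<m}"
      then have "p \<in> h ` (X \<times> {..<n})" using A h by (auto simp: bij_betw_def)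
      then obtain x i where xi: "p = h (x, i)" "x \<in> X" "i < n" by auto
      have "(fst p, f x) \<in> near E k" using near_sym[OF E(2) close[OF xi(2,3)]] xi(1) by simp
      moreover have "fst p \<in> A" "fst p \<notin> B" using p by auto
      ultimately have "f x \<in> A"
        using near_crosses_boundary near_sym[OF E(2)] unfolding B_def in_thicken_iff by meson
      then show "p \<in> h ` (S \<times> {..<n})" using xi by (auto simp: S_def)
    qed
    have fin: "finite ((A \<union> B) \<times> {..<m})" using A B by simp
    have "finite (S \<times> {..<n})" using finite_imageD[OF finite_subset[OF sub1 fin] inj] .
    then have finS: "finite S" using mn by (auto simp: finite_cartesian_product_iff lessThan_empty_iff)
    have "card (h ` (S \<times> {..<n})) = card S * n" using card_image[OF inj] by (simp add: card_cartesian_product)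
    then have "card S * n \<le> card (A \<union> B) * m" "card (A - B) * m \<le> card S * n"
      using card_mono[OF fin sub1] card_mono[OF _ sub2] finS by (simp_all add: card_cartesian_product)
    moreover have "card (A \<union> B) * m \<le> card A * m + card B * m"
      using card_Un_le[of A B] by (metis add_mult_distrib mult_le_mono1)
    moreover have "card A * m \<le> card (A - B) * m + card B * m"
      using diff_card_le_card_Diff[of B A] B by (metis add_mult_distrib le_diff_conv mult_le_mono1)
    moreover define b where "b = m * (D + 1) ^ k * card (vertex_boundary E A)"
    have "card B * m \<le> b"
      unfolding b_def using mult_le_mono1[OF B(2), of m] by (simp add: mult_ac)
    ultimately have le: "card S * n \<le> card A * m + b" "card A * m \<le> card S * n + b" by linarith+
    have "\<bar>real m * real (card A) - real n * real (card S)\<bar> \<le> real b"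
      using of_nat_mono[OF le(1), where 'a = real] of_nat_mono[OF le(2), where 'a = real]
      by (simp add: mult.commute abs_le_iff)
    also have "\<dots> \<le> real n * real b"
      using mn by (simp add: mult_le_cancel_right1)
    finally have "\<bar>real m * real (card A) - real n * real (card S)\<bar> / real n \<le> real b"
      using mn by (simp add: divide_le_eq mult.commute)
    moreover have "real m / real n * real (card A) - real (card S) =
        (real m * real (card A) - real n * real (card S)) / real n"
      using mn by (simp add: field_simps)
    ultimately show ?thesis using finS mn by (simp add: S_def b_def)
  qed
  moreover have "real (m * (D + 1) ^ k) > 0" using mn by simp
  ultimately show ?thesis unfolding quasi_to_one_def by blast
qed

section \<open>Hall inequalities for quasi-to-one maps\<close>

lemma card_thicken_layers:
  assumes fin: "\<And>l. finite (thicken E l A)" and "i \<le> j"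
  shows "card (thicken E j A) =
    card (thicken E i A) + (\<Sum>l\<in>{i..<j}. card (vertex_boundary E (thicken E l A)))"
  using \<open>i \<le> j\<close>
proof (induction j rule: dec_induct)
  case (step j)
  have "card (thicken E (Suc j) A) = card (thicken E j A) + card (vertex_boundary E (thicken E j A))"
    unfolding thicken_Suc using fin[of j] fin[of "Suc j"]
    by (intro card_Un_disjoint) (auto simp: thicken_Suc vertex_boundary_def)
  then show ?case using step by simp
qed simp

text \<open>
  An index at which \<open>s\<close> is smallest is outweighed by the remaining terms of the sum, even after
  deleting any \<open>W\<close>. Below, \<open>W\<close> is a window of \<open>K\<close> layers next to the chosen one, in which density of
  the image of \<open>f\<close> gives no information.
\<close>
lemma minimum_times_card_le_sum:
  fixes s :: "'a \<Rightarrow> nat"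
  assumes "finite J" "J \<noteq> {}"
  shows "\<exists>k\<in>J. \<forall>W. finite W \<longrightarrow> (card J - card W) * s k \<le> (\<Sum>j\<in>J - W. s j)"
proof -
  obtain k where k: "k \<in> J" "\<And>j. j \<in> J \<Longrightarrow> s k \<le> s j"
    using ex_min_if_finite[of "s ` J"] assms by (auto simp: not_less)
  have "(card J - card W) * s k \<le> (\<Sum>j\<in>J - W. s j)" if "finite W" for W
  proof -
    have "(card J - card W) * s k \<le> card (J - W) * s k"
      using diff_card_le_card_Diff[OF that] by (rule mult_le_mono1)
    also have "\<dots> \<le> (\<Sum>j\<in>J - W. s j)"
      using sum_bounded_below[of "J - W" "s k" s] k(2) by simp
    finally show ?thesis .
  qed
  then show ?thesis using k(1) by blast
qed

text \<open>
  The final counts for the two bounds below. Here \<open>t\<close> and \<open>q\<close> are the sizes of the chosen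
  neighbourhood and of the fibre over it, \<open>s\<close> is the size of its boundary, \<open>u\<close> and \<open>w\<close> are the numbers
  of points in the layers inside and outside of it, and \<open>p\<close> is the number of fibre points that are
  known to lie over the layers on one side.
\<close>
lemma upper_bound_arithmetic:
  fixes n m :: nat
  assumes "n * q \<le> m * t + c * s" "a + p \<le> q" "u \<le> v * p" "c * v * s \<le> u + w"
    and "v \<ge> 1" "m \<ge> 1" "n \<ge> 1"
  shows "n * a \<le> m * (t + w)"
proof (rule ccontr)
  assume "\<not> ?thesis"
  then have "m * t + m * w + 1 \<le> n * a" by (simp add: algebra_simps)
  moreover have "n * a + n * p \<le> n * q"
    using mult_le_mono2[OF assms(2), of n] by (simp add: algebra_simps)
  moreover have "w \<le> m * w" "p \<le> n * p" using assms by auto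
  ultimately have "w + p + 1 \<le> c * s" using assms(1) by linarith
  then have "v * (w + p + 1) \<le> v * (c * s)" by (rule mult_le_mono2)
  then have "v * w + v * p + v \<le> c * v * s" by (simp add: algebra_simps)
  moreover have "w \<le> v * w" using assms by auto
  ultimately show False using assms by linarith
qed

lemma lower_bound_arithmetic:
  fixes n m :: nat
  assumes "m * (b + u) \<le> n * q + c * s" "q + p \<le> r" "w \<le> v * p" "c * v * s \<le> u + w"
    and "v \<ge> 1" "m \<ge> 1" "n \<ge> 1"
  shows "m * b \<le> n * r"
proof (rule ccontr)
  assume "\<not> ?thesis"
  then have "n * r + 1 \<le> m * b" by simp
  moreover have "n * q + n * p \<le> n * r"
    using mult_le_mono2[OF assms(2), of n] by (simp add: algebra_simps)
  moreover have "u \<le> m * u" "p \<le> n * p" using assms by auto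
  ultimately have "u + p + 1 \<le> c * s" using assms(1) unfolding distrib_left by linarith
  then have "v * (u + p + 1) \<le> v * (c * s)" by (rule mult_le_mono2)
  then have "v * u + v * p + v \<le> c * v * s" by (simp add: algebra_simps)
  moreover have "u \<le> v * u" using assms by auto
  ultimately show False using assms by linarith
qed

text \<open>
  Clearing denominators and splitting the absolute value leaves counting arguments in natural numbers.
\<close>
lemma quasi_to_one_natE:
  fixes m n :: nat
  assumes "quasi_to_one (real m / real n) X Y E f" "n \<ge> 1"
  obtains c where "\<And>A. finite A \<Longrightarrow> A \<subseteq> Y \<Longrightarrow> finite (f -` A \<inter> X)"
    and "\<And>A. finite A \<Longrightarrow> A \<subseteq> Y \<Longrightarrow>
      m * card A \<le> n * card (f -` A \<inter> X) + c * card (vertex_boundary E A)"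
    and "\<And>A. finite A \<Longrightarrow> A \<subseteq> Y \<Longrightarrow>
      n * card (f -` A \<inter> X) \<le> m * card A + c * card (vertex_boundary E A)"
proof -
  obtain C where C: "C > 0" and q: "\<And>A. finite A \<Longrightarrow> A \<subseteq> Y \<Longrightarrow> finite (f -` A \<inter> X) \<and>
      \<bar>real m / real n * real (card A) - real (card (f -` A \<inter> X))\<bar>
        \<le> C * real (card (vertex_boundary E A))"
    using assms(1) unfolding quasi_to_one_def by blast
  define c where "c = nat \<lceil>real n * C\<rceil>"
  have c: "\<bar>real (m * card A) - real (n * card (f -` A \<inter> X))\<bar> \<le> real (c * card (vertex_boundary E A))"
    if "finite A" "A \<subseteq> Y" for A
  proof -
    have "\<bar>real (m * card A) - real (n * card (f -` A \<inter> X))\<bar> =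
        real n * \<bar>real m / real n * real (card A) - real (card (f -` A \<inter> X))\<bar>"
      using assms(2) by (simp add: abs_mult_pos' right_diff_distrib)
    also have "\<dots> \<le> real n * (C * real (card (vertex_boundary E A)))"
      using q[OF that] by (intro mult_left_mono) auto
    also have "\<dots> \<le> real c * real (card (vertex_boundary E A))"
      unfolding c_def mult.assoc[symmetric] by (intro mult_right_mono real_nat_ceiling_ge) auto
    finally show ?thesis by simp
  qed
  show ?thesis
  proof (rule that[of c])
    fix A assume A: "finite A" "A \<subseteq> Y"
    show "finite (f -` A \<inter> X)" using q[OF A] by blast
    have "real (m * card A) \<le> real (n * card (f -` A \<inter> X) + c * card (vertex_boundary E A))"
      using c[OF A] by simp
    then show "m * card A \<le> n * card (f -` A \<inter> X) + c * card (vertex_boundary E A)"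
      by (simp only: of_nat_le_iff)
    have "real (n * card (f -` A \<inter> X)) \<le> real (m * card A + c * card (vertex_boundary E A))"
      using c[OF A] by simp
    then show "n * card (f -` A \<inter> X) \<le> m * card A + c * card (vertex_boundary E A)"
      by (simp only: of_nat_le_iff)
  qed
qed

text \<open>
  Write \<open>\<phi> A\<close> for the size of the fibre over \<open>A\<close> and \<open>s k\<close> for the size of the boundary of the
  \<open>k\<close>-neighbourhood of \<open>B\<close>. The hypothesis on the \<open>k\<close>-neighbourhood bounds \<open>n * \<phi>\<close> of it by \<open>m\<close> times
  its size, up to an error \<open>c * s k\<close>, in both directions. To pass from there to \<open>B\<close> or to the
  \<open>R\<close>-neighbourhood, one gains the layers on one side of \<open>k\<close> as points of \<open>Y\<close> and those on the other
  side as points of the fibre. The latter are bounded below by density of the image of \<open>f\<close>: every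
  point of a layer has a fibre point over its \<open>K\<close>-ball, and at most \<open>v\<close> points share the same one.
  So it suffices that all these layers have at least \<open>c * v * s k\<close> points together, which holds for
  the \<open>k\<close> that minimises \<open>s\<close> once there are enough layers.
\<close>
theorem quasi_to_one_imp_thickened_bounds:
  fixes m n :: nat
  assumes E: "E \<subseteq> Y \<times> Y" "sym E" and deg: "\<forall>y\<in>Y. finite (E `` {y}) \<and> card (E `` {y}) \<le> D"
    and mn: "m \<ge> 1" "n \<ge> 1" and f: "f \<in> X \<rightarrow> Y"
    and dense: "\<And>y. y \<in> Y \<Longrightarrow> \<exists>x\<in>X. (y, f x) \<in> near E K"
    and quasi: "quasi_to_one (real m / real n) X Y E f"
  shows "\<exists>R. \<forall>B. finite B \<and> B \<subseteq> Y \<longrightarrow>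
    n * card (f -` B \<inter> X) \<le> m * card (thicken E R B) \<and>
    m * card B \<le> n * card (f -` (thicken E R B) \<inter> X)"
proof -
  define \<phi> where "\<phi> A = card (f -` A \<inter> X)" for A
  obtain c where fin_pre: "\<And>A. finite A \<Longrightarrow> A \<subseteq> Y \<Longrightarrow> finite (f -` A \<inter> X)"
    and lower: "\<And>A. finite A \<Longrightarrow> A \<subseteq> Y \<Longrightarrow> m * card A \<le> n * \<phi> A + c * card (vertex_boundary E A)"
    and upper: "\<And>A. finite A \<Longrightarrow> A \<subseteq> Y \<Longrightarrow> n * \<phi> A \<le> m * card A + c * card (vertex_boundary E A)"
    using quasi_to_one_natE[OF quasi mn(2)] unfolding \<phi>_def by metis
  define v where "v = (D + 1) ^ K"
  have v: "v \<ge> 1" by (simp add: v_def)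
  have sparse: "card A \<le> v * \<phi> (thicken E K A)" if A: "finite A" "A \<subseteq> Y" for A
  proof -
    let ?S = "f -` (thicken E K A) \<inter> X"
    have T: "finite (thicken E K A)" "thicken E K A \<subseteq> Y"
      using card_thicken_le[OF E(1) deg A] thicken_closed[OF E(1) A(2)] by blast+
    have S: "finite ?S" using fin_pre T by blast
    have sub: "f ` ?S \<subseteq> Y" using f by blast
    have "A \<subseteq> thicken E K (f ` ?S)"
    proof
      fix a assume a: "a \<in> A"
      then obtain x where x: "x \<in> X" "(a, f x) \<in> near E K" using dense A by blast
      then have "x \<in> ?S" using a by (auto simp: in_thicken_iff)
      then have "f x \<in> f ` ?S" by (rule imageI)
      then show "a \<in> thicken E K (f ` ?S)"
        using near_sym[OF E(2) x(2)] unfolding in_thicken_iff[of a] by blast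
    qed
    then have "card A \<le> v * card (f ` ?S)"
      using card_thicken_le[OF E(1) deg finite_imageI[OF S] sub, of K] unfolding v_def
      by (meson card_mono order_trans)
    also have "\<dots> \<le> v * \<phi> (thicken E K A)"
      unfolding \<phi>_def using card_image_le[OF S] by (rule mult_le_mono2)
    finally show ?thesis .
  qed
  have super: "\<phi> A + \<phi> A' \<le> \<phi> A''"
    if "finite A''" "A'' \<subseteq> Y" "A \<union> A' \<subseteq> A''" "A \<inter> A' = {}" for A A' A''
  proof -
    have "finite (f -` A'' \<inter> X)" using fin_pre that by blast
    then have "card ((f -` A \<inter> X) \<union> (f -` A' \<inter> X)) \<le> \<phi> A''" and
      "finite (f -` A \<inter> X)" "finite (f -` A' \<inter> X)"
      unfolding \<phi>_def using that by (auto intro!: card_mono elim!: rev_finite_subset)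
    moreover have "(f -` A \<inter> X) \<inter> (f -` A' \<inter> X) = {}" using that by blast
    ultimately show ?thesis by (simp add: \<phi>_def card_Un_disjoint)
  qed
  \<comment> \<open>Upper bound: of the layers from \<open>2 * K\<close> to \<open>R\<close>, a window of \<open>K\<close> is lost, which leaves more
    than \<open>c * v\<close>. The lower bound uses the layers from \<open>0\<close> to \<open>R - K\<close>.\<close>
  define R where "R = 3 * K + c * v + 1"
  have "n * \<phi> B \<le> m * card (thicken E R B) \<and> m * card B \<le> n * \<phi> (thicken E R B)"
    if B: "finite B" "B \<subseteq> Y" for B
  proof
    let ?T = "\<lambda>l. thicken E l B"
    define s where "s l = card (vertex_boundary E (?T l))" for l
    have T: "finite (?T l)" "?T l \<subseteq> Y" for l
      using card_thicken_le[OF E(1) deg B] thicken_closed[OF E(1) B(2)] by blast+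
    have layers: "card (?T j) = card (?T i) + sum s {i..<j}" if "i \<le> j" for i j
      unfolding s_def using card_thicken_layers[OF T(1) that] .
    have annulus: "sum s {i..<j} \<le> v * \<phi> (thicken E K (?T j - ?T i))" for i j
    proof (cases "i \<le> j")
      case True
      have "sum s {i..<j} = card (?T j - ?T i)"
        using layers[OF True] card_Diff_subset[OF T(1) thicken_mono[OF True]] by simp
      then show ?thesis using sparse[of "?T j - ?T i"] T by fastforce
    qed simp
    have thicken_annulus: "thicken E K (?T j - ?T i) \<subseteq> ?T (j + K) - ?T l" if "l + K \<le> i" for i j l
    proof
      fix y assume "y \<in> thicken E K (?T j - ?T i)"
      then obtain z where z: "z \<in> ?T j" "z \<notin> ?T i" "(z, y) \<in> near E K"
        by (auto simp: in_thicken_iff)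
      have "y \<in> ?T (j + K)"
        using z(1,3) by (subst thicken_thicken[symmetric]) (auto simp: in_thicken_iff[of y])
      moreover have "y \<notin> ?T l"
      proof
        assume "y \<in> ?T l"
        then have "z \<in> ?T (l + K)"
          using near_sym[OF E(2) z(3)]
          by (subst thicken_thicken[symmetric]) (auto simp: in_thicken_iff[of z])
        then show False using z(2) thicken_mono[OF that, of E B] by blast
      qed
      ultimately show "y \<in> ?T (j + K) - ?T l" by blast
    qed
    show "n * \<phi> B \<le> m * card (?T R)"
    proof -
      obtain k where k: "k \<in> {2 * K..<R}" and
        W: "\<And>W. finite W \<Longrightarrow> (card {2 * K..<R} - card W) * s k \<le> sum s ({2 * K..<R} - W)"
        using minimum_times_card_le_sum[of "{2 * K..<R}" s] by (auto simp: R_def)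
      have "c * v * s k \<le> (card {2 * K..<R} - card {k - K..<k}) * s k"
        by (intro mult_le_mono1) (simp add: R_def)
      also have "\<dots> \<le> sum s ({2 * K..<R} - {k - K..<k})" by (rule W) simp
      also have "\<dots> \<le> sum s ({K..<k - K} \<union> {k..<R})" by (intro sum_mono2) auto
      also have "\<dots> = sum s {K..<k - K} + sum s {k..<R}" by (intro sum.union_disjoint) auto
      finally have window: "c * v * s k \<le> sum s {K..<k - K} + sum s {k..<R}" .
      \<comment> \<open>The points whose \<open>K\<close>-ball avoids \<open>B\<close> and stays in the \<open>k\<close>-neighbourhood of \<open>B\<close>:
        the fibre points forced by them are not counted by \<open>\<phi> B\<close>.\<close>
      let ?A = "thicken E K (?T (k - K) - ?T K)"
      have "?A \<subseteq> ?T k - B" using thicken_annulus[of 0 K "k - K"] k by simp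
      then have "\<phi> B + \<phi> ?A \<le> \<phi> (?T k)"
        using T subset_thicken[of B E k] by (intro super) auto
      then have "n * \<phi> B \<le> m * (card (?T k) + sum s {k..<R})"
        using upper_bound_arithmetic[OF _ _ annulus window v mn] upper[OF T, of k]
        unfolding s_def by blast
      then show ?thesis using layers[of k R] k by simp
    qed
    show "m * card B \<le> n * \<phi> (?T R)"
    proof -
      obtain k where k: "k \<in> {0..<R - K}" and
        W: "\<And>W. finite W \<Longrightarrow> (card {0..<R - K} - card W) * s k \<le> sum s ({0..<R - K} - W)"
        using minimum_times_card_le_sum[of "{0..<R - K}" s] by (auto simp: R_def)
      have "c * v * s k \<le> (card {0..<R - K} - card {k..<k + K}) * s k"
        by (intro mult_le_mono1) (simp add: R_def)
      also have "\<dots> \<le> sum s ({0..<R - K} - {k..<k + K})" by (rule W) simp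
      also have "\<dots> \<le> sum s ({0..<k} \<union> {k + K..<R - K})" by (intro sum_mono2) auto
      also have "\<dots> = sum s {0..<k} + sum s {k + K..<R - K}" by (intro sum.union_disjoint) auto
      finally have window: "c * v * s k \<le> sum s {0..<k} + sum s {k + K..<R - K}" .
      let ?A = "thicken E K (?T (R - K) - ?T (k + K))"
      have "?A \<subseteq> ?T R - ?T k" using thicken_annulus[of k "k + K" "R - K"] by (simp add: R_def)
      then have "\<phi> (?T k) + \<phi> ?A \<le> \<phi> (?T R)"
        using T thicken_mono[of k R E B] k by (intro super) auto
      moreover have "m * (card B + sum s {0..<k}) \<le> n * \<phi> (?T k) + c * s k"
        using lower[OF T, of k] layers[of 0 k] by (simp add: s_def)
      ultimately show ?thesis
        using lower_bound_arithmetic[OF _ _ annulus window v mn] by blast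
    qed
  qed
  then show ?thesis unfolding \<phi>_def by blast
qed

section \<open>Partitions of graphs into bounded pieces of equal size\<close>

lemma finite_set_equipartition:
  fixes n :: nat
  assumes "finite A" "n dvd card A" "n \<ge> 1"
  shows "\<exists>P. partition_on A P \<and> (\<forall>Q\<in>P. card Q = n)"
  using assms
proof (induction "card A" arbitrary: A rule: less_induct)
  case less
  show ?case
  proof (cases "A = {}")
    case True
    then show ?thesis by (intro exI[of _ "{}"]) (simp add: partition_on_empty)
  next
    case False
    then have "n \<le> card A" using less.prems by (intro dvd_imp_le) (auto simp: card_gt_0_iff)
    then obtain Q where Q: "Q \<subseteq> A" "card Q = n" using obtain_subset_with_card_n by metis
    have fQ: "finite Q" using Q less.prems(1) finite_subset by blast
    then have card: "card (A - Q) = card A - n" using Q by (simp add: card_Diff_subset)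
    then have "card (A - Q) < card A" using less.prems \<open>n \<le> card A\<close> by simp
    then obtain P where P: "partition_on (A - Q) P" "\<forall>R\<in>P. card R = n"
      using less.hyps[of "A - Q"] less.prems card by (auto simp: dvd_diff_nat)
    have "disjnt Q (\<Union>P)" using partition_onD1[OF P(1)] by (auto simp: disjnt_def)
    moreover have "Q \<noteq> {}" using Q less.prems by auto
    ultimately have "partition_on A (insert Q P)" using P(1) Q by (simp add: partition_on_insert)
    then show ?thesis using P(2) Q(2) by auto
  qed
qed

text \<open>
  The well-founded relation says that one cannot go backwards along \<open>s\<close> for ever, so that data can be
  passed along \<open>s\<close> by recursion, from each vertex on towards infinity. In a breadth-first spanning
  tree let \<open>Big\<close> be the set of vertices with infinitely many descendants. It contains the root, and
  each of its members has a child in it, as there are finitely many children. Let \<open>s\<close> take a big vertex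
  to a big child and any other vertex to its parent. A backward step then goes from a big vertex to
  its parent or into a finite subtree, and inside a finite subtree only to smaller ones.
\<close>
lemma locally_finite_graph_successor:
  assumes "connected_graph V E" "infinite V" and locfin: "\<And>v. v \<in> V \<Longrightarrow> finite (E `` {v})"
  shows "\<exists>s. (\<forall>v\<in>V. (v, s v) \<in> E) \<and> wf {(u, v). u \<in> V \<and> v = s u}"
proof -
  have E: "E \<subseteq> V \<times> V" "sym E" and conn: "\<And>x y. x \<in> V \<Longrightarrow> y \<in> V \<Longrightarrow> (x, y) \<in> E\<^sup>*"
    using assms(1) by (auto simp: connected_graph_def simple_graph_def)
  obtain r where r: "r \<in> V" using \<open>infinite V\<close> by fastforce
  define depth where "depth v = (LEAST k. (r, v) \<in> E ^^ k)" for v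
  have depth_walk: "(r, v) \<in> E ^^ depth v" if "v \<in> V" for v
    using rtrancl_imp_relpow[OF conn[OF r that]] unfolding depth_def by (auto intro: LeastI)
  have "\<exists>p. (v, p) \<in> E \<and> depth p < depth v" if "v \<in> V - {r}" for v
  proof -
    have v: "v \<in> V" "v \<noteq> r" using that by auto
    then have "depth v \<noteq> 0" using depth_walk[OF v(1)] by (metis relpow_0_E)
    then obtain k where k: "depth v = Suc k" by (cases "depth v") auto
    then obtain p where p: "(r, p) \<in> E ^^ k" "(p, v) \<in> E" using depth_walk[OF v(1)] by auto
    have "depth p \<le> k" unfolding depth_def using p(1) by (rule Least_le)
    then show ?thesis using p(2) k E(2) by (auto dest: symD)
  qed
  then obtain par where par: "\<And>v. v \<in> V - {r} \<Longrightarrow> (v, par v) \<in> E"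
    and depth_par: "\<And>v. v \<in> V - {r} \<Longrightarrow> depth (par v) < depth v"
    by metis
  define T where "T = {(c, par c) | c. c \<in> V - {r}}"
  define desc where "desc v = {u. (u, v) \<in> T\<^sup>*}" for v
  have desc_depth: "depth v \<le> depth u" if "u \<in> desc v" for u v
  proof -
    have "(u, v) \<in> T\<^sup>*" using that by (simp add: desc_def)
    then show ?thesis
      by (induction rule: rtrancl_induct) (use depth_par in \<open>fastforce simp: T_def\<close>)+
  qed
  have root: "V \<subseteq> desc r"
  proof
    fix v assume "v \<in> V"
    then show "v \<in> desc r"
    proof (induction "depth v" arbitrary: v rule: less_induct)
      case less
      show ?case
      proof (cases "v = r")
        case False
        then have v: "v \<in> V - {r}" using less.prems by blast
        then have "par v \<in> V" using par[OF v] E(1) by blast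
        then have "(par v, r) \<in> T\<^sup>*" using less.hyps[OF depth_par[OF v]] by (simp add: desc_def)
        moreover have "(v, par v) \<in> T" using v by (auto simp: T_def)
        ultimately show ?thesis by (simp add: desc_def converse_rtrancl_into_rtrancl)
      qed (simp add: desc_def)
    qed
  qed
  define Big where "Big = {v \<in> V. infinite (desc v)}"
  have "\<exists>c\<in>Big. (c, v) \<in> T" if "v \<in> Big" for v
  proof (rule ccontr)
    assume neg: "\<not> ?thesis"
    have child: "c \<in> E `` {v}" "c \<in> V" if "(c, v) \<in> T" for c
      using that par E by (auto simp: T_def dest: symD)
    have "desc v \<subseteq> insert v (\<Union>c\<in>{c. (c, v) \<in> T}. desc c)"
    proof
      fix u assume "u \<in> desc v"
      then have "(u, v) \<in> T\<^sup>*" by (simp add: desc_def)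
      then show "u \<in> insert v (\<Union>c\<in>{c. (c, v) \<in> T}. desc c)"
        by (cases rule: rtranclE) (auto simp: desc_def)
    qed
    moreover have "finite {c. (c, v) \<in> T}"
      using child(1) locfin[of v] \<open>v \<in> Big\<close> by (auto simp: Big_def intro: finite_subset)
    moreover have "finite (desc c)" if "(c, v) \<in> T" for c
      using neg child(2)[OF that] that by (auto simp: Big_def)
    ultimately have "finite (desc v)" by (auto intro: finite_subset)
    then show False using \<open>v \<in> Big\<close> by (simp add: Big_def)
  qed
  then have "\<exists>c. c \<in> Big \<and> c \<in> V - {r} \<and> par c = v" if "v \<in> Big" for v
    using that by (fastforce simp: T_def)
  then obtain big_child where bc: "\<And>v. v \<in> Big \<Longrightarrow> big_child v \<in> Big"
    "\<And>v. v \<in> Big \<Longrightarrow> big_child v \<in> V - {r}" "\<And>v. v \<in> Big \<Longrightarrow> par (big_child v) = v"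
    by metis
  define s where "s v = (if v \<in> Big then big_child v else par v)" for v
  have not_Big: "v \<in> V - {r}" if "v \<in> V" "v \<notin> Big" for v
    using that root r \<open>infinite V\<close> finite_subset by (auto simp: Big_def)
  have "(v, s v) \<in> E" if "v \<in> V" for v
  proof (cases "v \<in> Big")
    case True
    then have "(big_child v, v) \<in> E" using par[OF bc(2)[OF True]] bc(3)[OF True] by simp
    then show ?thesis using True E(2) by (auto simp: s_def dest: symD)
  qed (use par[OF not_Big[OF that]] in \<open>simp add: s_def\<close>)
  moreover have "wf {(u, v). u \<in> V \<and> v = s u}"
  proof (rule wf_subset)
    let ?\<mu> = "\<lambda>v. if v \<in> Big then (1::nat, depth v) else (0, card (desc v))"
    show "wf (inv_image (less_than <*lex*> less_than) ?\<mu>)" by auto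
    have "(?\<mu> u, ?\<mu> (s u)) \<in> less_than <*lex*> less_than" if u: "u \<in> V" for u
    proof (cases "u \<in> Big")
      case True
      then have "depth u < depth (big_child u)" using depth_par[OF bc(2)[OF True]] bc(3)[OF True] by simp
      then show ?thesis using True bc(1) by (simp add: s_def)
    next
      case False
      note u' = not_Big[OF u False]
      show ?thesis
      proof (cases "par u \<in> Big")
        case notBig: False
        have "par u \<in> V" using par[OF u'] E(1) by blast
        then have "finite (desc (par u))" using notBig by (simp add: Big_def)
        moreover have "(u, par u) \<in> T" using u' by (auto simp: T_def)
        then have "desc u \<subseteq> desc (par u)" by (auto simp: desc_def)
        moreover have "par u \<notin> desc u" using desc_depth[of "par u" u] depth_par[OF u'] by auto
        then have "desc u \<noteq> desc (par u)" by (auto simp: desc_def)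
        ultimately have "card (desc u) < card (desc (par u))" by (intro psubset_card_mono) auto
        then show ?thesis using False notBig by (simp add: s_def)
      qed (use False in \<open>simp add: s_def\<close>)
    qed
    then show "{(u, v). u \<in> V \<and> v = s u} \<subseteq> inv_image (less_than <*lex*> less_than) ?\<mu>"
      by (auto simp only: in_inv_image)
  qed
  ultimately show ?thesis by blast
qed

text \<open>
  When \<open>s\<close> has no cycles and \<open>A\<close> is finite, this says that iterating \<open>s\<close> leads from every element of
  \<open>A\<close> to \<open>v\<close> without leaving \<open>A\<close>. It forces the elements of a small such set to be near \<open>v\<close>.
\<close>
definition closed_towards :: "('a \<Rightarrow> 'a) \<Rightarrow> 'a \<Rightarrow> 'a set \<Rightarrow> bool" where
  "closed_towards s v A \<longleftrightarrow> (\<forall>x\<in>A. x = v \<or> s x \<in> A)"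

text \<open>
  Elements can be removed one at a time, each time one that is not the image of another element.
\<close>
lemma closed_towards_subset_of_card:
  assumes wf: "wf {(u, v). u \<in> V \<and> v = s u}"
    and "finite A" "A \<subseteq> V" "closed_towards s v A" "c \<le> card A"
  shows "\<exists>L\<subseteq>A. closed_towards s v L \<and> card L = c"
  using assms(2-)
proof (induction "card A" arbitrary: A rule: less_induct)
  case less
  show ?case
  proof (cases "c = card A")
    case False
    then have c: "c < card A" using less.prems by simp
    then obtain a where "a \<in> A" by fastforce
    then obtain z where z: "z \<in> A" and min: "\<And>u. (u, z) \<in> {(u, v). u \<in> V \<and> v = s u} \<Longrightarrow> u \<notin> A"
      by (rule wfE_min[OF wf]) blast
    have "closed_towards s v (A - {z})"
      using less.prems min by (auto simp: closed_towards_def)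
    moreover have "card (A - {z}) = card A - 1" using z less.prems by simp
    moreover have "A - {z} \<subseteq> V" using less.prems by blast
    ultimately have "\<exists>L\<subseteq>A - {z}. closed_towards s v L \<and> card L = c"
      using less.hyps[of "A - {z}"] less.prems(1) c by simp
    then obtain L where "L \<subseteq> A - {z}" "closed_towards s v L" "card L = c" by blast
    then show ?thesis by blast
  qed (use less.prems in blast)
qed

text \<open>
  Every vertex \<open>v\<close> collects the set \<open>T v\<close> that consists of \<open>v\<close> and the leftovers of its predecessors
  under \<open>s\<close>. It passes on a leftover \<open>L v\<close> of fewer than \<open>n\<close> points and keeps \<open>W v\<close>, whose
  size is a multiple of \<open>n\<close>. If the leftover were an arbitrary subset, a point could be passed on
  for ever; as it is closed towards \<open>v\<close> and has fewer than \<open>n\<close> elements, its points are fewer than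
  \<open>n\<close> steps away from \<open>v\<close>. So every point is kept eventually, at a vertex within \<open>n\<close> steps, and
  cutting up the sets \<open>W v\<close> gives the partition.
\<close>
theorem infinite_graph_equipartition:
  fixes n :: nat
  assumes graph: "connected_graph V E" and inf: "infinite V"
    and locfin: "\<And>v. v \<in> V \<Longrightarrow> finite (E `` {v})" and "n \<ge> 1"
  shows "\<exists>P. partition_on V P \<and> (\<forall>Q\<in>P. card Q = n \<and> Q \<times> Q \<subseteq> near E (2 * n))"
proof -
  have E: "E \<subseteq> V \<times> V" "sym E"
    using graph by (auto simp: connected_graph_def simple_graph_def)
  obtain s where s: "\<And>v. v \<in> V \<Longrightarrow> (v, s v) \<in> E" and wf: "wf {(u, v). u \<in> V \<and> v = s u}"
    using locally_finite_graph_successor[OF graph inf locfin] by blast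
  let ?R = "{(u, v). u \<in> V \<and> v = s u}"
  have sV: "s v \<in> V" if "v \<in> V" for v using s[OF that] E by blast
  have iter_V: "(s ^^ k) v \<in> V" if "v \<in> V" for v k
    using that sV by (induction k) auto
  have iter_plus: "(v, (s ^^ k) v) \<in> ?R\<^sup>+" if "v \<in> V" "k > 0" for v k
    using that(2)
  proof (induction k)
    case (Suc k)
    have "((s ^^ k) v, (s ^^ Suc k) v) \<in> ?R" using iter_V[OF that(1)] by simp
    then show ?case using Suc.IH by (cases "k = 0") (auto intro: trancl_into_trancl)
  qed simp
  have iter_less: "(s ^^ i) v \<noteq> (s ^^ j) v" if "v \<in> V" "i < j" for v i j
  proof
    assume eq: "(s ^^ i) v = (s ^^ j) v"
    have "(s ^^ j) v = (s ^^ (j - i)) ((s ^^ i) v)"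
      using that(2) by (metis add_diff_inverse_nat comp_apply funpow_add less_imp_le_nat add.commute not_less)
    then have "((s ^^ i) v, (s ^^ i) v) \<in> ?R\<^sup>+"
      using iter_plus[OF iter_V[OF that(1)], of "j - i" i] that(2) eq by simp
    then show False using wf_acyclic[OF wf] by (simp add: acyclic_def)
  qed
  have iter_inj: "i = j" if "v \<in> V" "(s ^^ i) v = (s ^^ j) v" for v i j
    using iter_less[OF that(1)] that(2) by (metis nat_neq_iff)
  have iter_near: "(v, (s ^^ k) v) \<in> near E k" if "v \<in> V" for v k
  proof (induction k)
    case (Suc k)
    have "((s ^^ k) v, (s ^^ Suc k) v) \<in> E\<^sup>=" using s[OF iter_V[OF that]] by simp
    with Suc show ?case by (rule relpow_Suc_I)
  qed simp
  \<comment> \<open>\<open>L\<close> is a parameter of \<open>T\<close> because \<open>L v\<close> is chosen by recursion on predecessors.\<close>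
  define T where "T L v = insert v (\<Union>u\<in>{u \<in> V. s u = v}. L u)" for L :: "'a \<Rightarrow> 'a set" and v
  define good where "good L v r \<longleftrightarrow> (v \<in> V \<and> finite (T L v) \<and> T L v \<subseteq> V \<and> closed_towards s v (T L v) \<longrightarrow>
      r \<subseteq> T L v \<and> closed_towards s v r \<and> card r = card (T L v) mod n)" for L v r
  have "\<exists>L. \<forall>v. good L v (L v)"
  proof (rule dependent_wf_choice[OF wf])
    fix L L' :: "'a \<Rightarrow> 'a set" and v r assume "\<And>z. (z, v) \<in> ?R \<Longrightarrow> L z = L' z"
    then have "T L v = T L' v" by (auto simp: T_def)
    then show "good L v r = good L' v r" by (simp add: good_def)
  next
    fix v and L :: "'a \<Rightarrow> 'a set"
    show "\<exists>r. good L v r"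
      unfolding good_def using closed_towards_subset_of_card[OF wf, of "T L v" v "card (T L v) mod n"]
      by (meson mod_less_eq_dividend)
  qed
  then obtain L where good: "\<And>v. good L v (L v)" by blast
  have inv: "finite (T L v) \<and> T L v \<subseteq> V \<and> closed_towards s v (T L v)" if "v \<in> V" for v
    using that
  proof (induction v rule: wf_induct_rule[OF wf])
    case (1 v)
    have IH: "finite (L u) \<and> L u \<subseteq> V \<and> closed_towards s u (L u)" if "u \<in> V" "s u = v" for u
      using 1(1)[of u] that good[of u] unfolding good_def by (auto intro: finite_subset)
    have "{u \<in> V. s u = v} \<subseteq> E `` {v}" using s E(2) by (auto dest: symD)
    then have "finite {u \<in> V. s u = v}" using locfin[OF 1(2)] finite_subset by blast
    then have "finite (T L v)" "T L v \<subseteq> V" using IH 1(2) by (auto simp: T_def)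
    moreover have "closed_towards s v (T L v)"
      unfolding closed_towards_def
    proof
      fix x assume "x \<in> T L v"
      then consider "x = v" | u where "u \<in> V" "s u = v" "x \<in> L u" by (auto simp: T_def)
      then show "x = v \<or> s x \<in> T L v"
      proof cases
        case 2
        then have "x = u \<or> s x \<in> L u" using IH by (simp add: closed_towards_def)
        then show ?thesis using 2 by (auto simp: T_def)
      qed simp
    qed
    ultimately show ?case by blast
  qed
  then have L: "L v \<subseteq> T L v" "closed_towards s v (L v)" "card (L v) = card (T L v) mod n"
    if "v \<in> V" for v
    using good[of v] that unfolding good_def by blast+
  have L_iter: "\<exists>k<n. (s ^^ k) x = v" if v: "v \<in> V" and x: "x \<in> L v" for v x
  proof (rule ccontr)
    assume neg: "\<not> ?thesis"
    have "(s ^^ k) x \<in> L v" if "k \<le> n" for k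
      using that
    proof (induction k)
      case (Suc k)
      then have "(s ^^ k) x \<in> L v" "(s ^^ k) x \<noteq> v" using neg by auto
      then show ?case using L(2)[OF v] by (auto simp: closed_towards_def)
    qed (use x in simp)
    then have "(\<lambda>k. (s ^^ k) x) ` {..n} \<subseteq> L v" by auto
    moreover have "finite (L v)" "x \<in> V" using L(1)[OF v] inv[OF v] x finite_subset by blast+
    moreover have "inj_on (\<lambda>k. (s ^^ k) x) {..n}" using iter_inj[OF \<open>x \<in> V\<close>] by (auto intro: inj_onI)
    ultimately have "n + 1 \<le> card (L v)" using card_inj_on_le by fastforce
    moreover have "card (L v) < n" using L(3)[OF v] \<open>n \<ge> 1\<close> by simp
    ultimately show False by simp
  qed
  have T_iter: "\<exists>k\<le>n. (s ^^ k) x = v" if v: "v \<in> V" and x: "x \<in> T L v" for v x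
  proof (cases "x = v")
    case True
    then show ?thesis by (intro exI[of _ 0]) simp
  next
    case False
    then obtain u where u: "u \<in> V" "s u = v" "x \<in> L u" using x by (auto simp: T_def)
    then obtain k where "k < n" "(s ^^ k) x = u" using L_iter by blast
    then show ?thesis using u(2) by (intro exI[of _ "Suc k"]) auto
  qed
  have T_path: "x \<in> L ((s ^^ j) x)" if "x \<in> V" "x \<in> T L ((s ^^ k) x)" "j < k" for x j k
    using that(2,3)
  proof (induction k)
    case (Suc k)
    have "x \<noteq> (s ^^ Suc k) x" using iter_less[OF that(1), of 0 "Suc k"] by simp
    then obtain u where u: "u \<in> V" "s u = (s ^^ Suc k) x" "x \<in> L u"
      using Suc.prems(1) by (auto simp: T_def)
    obtain i where i: "(s ^^ i) x = u" using L_iter[OF u(1,3)] by blast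
    then have "(s ^^ Suc i) x = (s ^^ Suc k) x" using u(2) by simp
    then have "i = k" using iter_inj[OF that(1)] by blast
    then have xk: "x \<in> L ((s ^^ k) x)" using i u(3) by simp
    then have "x \<in> T L ((s ^^ k) x)" using L(1) iter_V[OF that(1)] by blast
    then show ?case using Suc.IH Suc.prems(2) xk by (cases "j = k") auto
  qed simp
  define W where "W v = T L v - L v" for v
  have W_card: "n dvd card (W v)" "finite (W v)" if "v \<in> V" for v
  proof -
    have "finite (L v)" using inv[OF that] L(1)[OF that] finite_subset by blast
    then have "card (W v) = card (T L v) - card (T L v) mod n"
      unfolding W_def using L[OF that] by (simp add: card_Diff_subset)
    then show "n dvd card (W v)" by (simp add: dvd_minus_mod)
    show "finite (W v)" using inv[OF that] by (simp add: W_def)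
  qed
  have W_near: "W v \<times> W v \<subseteq> near E (2 * n)" if "v \<in> V" for v
  proof -
    have "(x, v) \<in> near E n" if x: "x \<in> W v" for x
    proof -
      have "x \<in> T L v" "x \<in> V" using x inv[OF \<open>v \<in> V\<close>] by (auto simp: W_def)
      then obtain k where "k \<le> n" "(s ^^ k) x = v" using T_iter[OF \<open>v \<in> V\<close>] by blast
      then show ?thesis using iter_near[OF \<open>x \<in> V\<close>, of k] near_mono by metis
    qed
    then show ?thesis
      using near_sym[OF E(2)] relpow_trans[of _ v n "E\<^sup>=" _ n] by (auto simp: mult_2)
  qed
  have W_cover: "(\<Union>v\<in>V. W v) = V"
  proof
    show "(\<Union>v\<in>V. W v) \<subseteq> V" using inv by (auto simp: W_def)
    show "V \<subseteq> (\<Union>v\<in>V. W v)"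
    proof (rule ccontr)
      assume "\<not> ?thesis"
      then obtain x where x: "x \<in> V" "\<And>v. v \<in> V \<Longrightarrow> x \<notin> W v" by blast
      have "x \<in> T L ((s ^^ k) x)" for k
      proof (induction k)
        case (Suc k)
        then have "x \<in> L ((s ^^ k) x)" using x(2)[OF iter_V[OF x(1)]] by (auto simp: W_def)
        then show ?case using iter_V[OF x(1)] by (auto simp: T_def)
      qed (simp add: T_def)
      then have "x \<in> T L ((s ^^ Suc n) x)" by blast
      then obtain k where "k \<le> n" "(s ^^ k) x = (s ^^ Suc n) x"
        using T_iter[OF iter_V[OF x(1)]] by blast
      then show False using iter_inj[OF x(1)] by fastforce
    qed
  qed
  have W_disj: "u = v" if uv: "u \<in> V" "v \<in> V" and x: "x \<in> W u" "x \<in> W v" for u v x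
  proof -
    have xV: "x \<in> V" using x(1) inv[OF uv(1)] by (auto simp: W_def)
    obtain i where i: "(s ^^ i) x = u" using T_iter[OF uv(1)] x(1) by (auto simp: W_def)
    obtain j where j: "(s ^^ j) x = v" using T_iter[OF uv(2)] x(2) by (auto simp: W_def)
    have "\<not> i < j" using T_path[OF xV, of j i] x i j by (auto simp: W_def)
    moreover have "\<not> j < i" using T_path[OF xV, of i j] x i j by (auto simp: W_def)
    ultimately show ?thesis using i j by (metis nat_neq_iff)
  qed
  have "\<exists>P. partition_on (W v) P \<and> (\<forall>Q\<in>P. card Q = n)" if "v \<in> V" for v
    using finite_set_equipartition[OF W_card(2,1) \<open>n \<ge> 1\<close>] that by blast
  then obtain \<P> where \<P>: "\<And>v. v \<in> V \<Longrightarrow> partition_on (W v) (\<P> v)"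
    "\<And>v Q. v \<in> V \<Longrightarrow> Q \<in> \<P> v \<Longrightarrow> card Q = n" by metis
  have sub: "Q \<subseteq> W v" if "v \<in> V" "Q \<in> \<P> v" for v Q
    using partition_onD1[OF \<P>(1)[OF that(1)]] that(2) by blast
  have "partition_on V (\<Union>v\<in>V. \<P> v)"
  proof (rule partition_onI)
    have "\<Union>(\<Union>v\<in>V. \<P> v) = (\<Union>v\<in>V. \<Union>(\<P> v))" by blast
    also have "\<dots> = (\<Union>v\<in>V. W v)" using partition_onD1[OF \<P>(1)] by simp
    finally show "\<Union>(\<Union>v\<in>V. \<P> v) = V" unfolding W_cover .
    show "{} \<notin> (\<Union>v\<in>V. \<P> v)" using \<P>(1) partition_onD3 by blast
    fix p q assume pq: "p \<in> (\<Union>v\<in>V. \<P> v)" "q \<in> (\<Union>v\<in>V. \<P> v)" "p \<noteq> q"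
    then obtain u v where uv: "u \<in> V" "v \<in> V" "p \<in> \<P> u" "q \<in> \<P> v" by blast
    show "disjnt p q"
    proof (cases "u = v")
      case True
      then show ?thesis using partition_onD2[OF \<P>(1)[OF uv(1)]] uv pq(3)
        by (auto simp: disjoint_def disjnt_def)
    next
      case False
      then show ?thesis using W_disj[OF uv(1,2)] sub uv by (auto simp: disjnt_def)
    qed
  qed
  moreover have "card Q = n \<and> Q \<times> Q \<subseteq> near E (2 * n)" if "Q \<in> (\<Union>v\<in>V. \<P> v)" for Q
    using that \<P>(2) sub W_near by blast
  ultimately show ?thesis by blast
qed

lemma graph_equipartition:
  fixes n :: nat
  assumes graph: "connected_graph V E"
    and locfin: "\<And>v. v \<in> V \<Longrightarrow> finite (E `` {v})" and n: "n \<ge> 1"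
    and div: "finite V \<Longrightarrow> n dvd card V"
  shows "\<exists>P k. partition_on V P \<and> (\<forall>Q\<in>P. card Q = n \<and> Q \<times> Q \<subseteq> near E k)"
proof (cases "finite V")
  case True
  obtain k where k: "V \<times> V \<subseteq> near E k" using finite_connected_graph_bounded[OF graph True] by blast
  obtain P where P: "partition_on V P" "\<forall>Q\<in>P. card Q = n"
    using finite_set_equipartition[OF True div[OF True] n] by blast
  have "Q \<times> Q \<subseteq> near E k" if "Q \<in> P" for Q
    using partition_onD1[OF P(1)] that k by blast
  then show ?thesis using P by blast
next
  case False
  then show ?thesis using infinite_graph_equipartition[OF graph False locfin n] by blast
qed

section \<open>The equivalence\<close>

lemma card_le_times_card_of_cover:
  assumes "finite \<Q>" "\<And>Q. Q \<in> \<Q> \<Longrightarrow> card Q = n" "A \<subseteq> \<Union>\<Q>" "\<And>Q. Q \<in> \<Q> \<Longrightarrow> finite Q"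
  shows "card A \<le> n * card \<Q>"
proof -
  have "card A \<le> card (\<Union>\<Q>)" using assms by (intro card_mono finite_Union) auto
  also have "\<dots> \<le> sum card \<Q>" by (rule card_Union_le_sum_card)
  finally show ?thesis using assms(2) by (simp add: mult.commute)
qed

text \<open>
  Matching \<open>x\<close> with \<open>m\<close> copies of each piece that meets the \<open>R\<close>-ball around \<open>f x\<close>, the two bounds
  become the two Hall conditions: the pieces that meet a set cover it, so there are at least \<open>1/n\<close>
  times as many of them as points, and a union of pieces has exactly \<open>n\<close> times as many points as
  pieces.
\<close>
theorem thickened_bounds_imp_matching:
  fixes m n :: nat
  assumes E: "E \<subseteq> Y \<times> Y" "sym E" and deg: "\<forall>y\<in>Y. finite (E `` {y}) \<and> card (E `` {y}) \<le> D"
    and n: "n \<ge> 1" and f: "f \<in> X \<rightarrow> Y"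
    and fin_pre: "\<And>A. finite A \<Longrightarrow> A \<subseteq> Y \<Longrightarrow> finite (f -` A \<inter> X)"
    and R1: "\<And>B. finite B \<Longrightarrow> B \<subseteq> Y \<Longrightarrow> n * card (f -` B \<inter> X) \<le> m * card (thicken E R B)"
    and R2: "\<And>B. finite B \<Longrightarrow> B \<subseteq> Y \<Longrightarrow> m * card B \<le> n * card (f -` (thicken E R B) \<inter> X)"
    and P: "partition_on Y P" "\<And>Q. Q \<in> P \<Longrightarrow> card Q = n"
  shows "\<exists>h. bij_betw h X (P \<times> {..<m}) \<and> (\<forall>x\<in>X. \<exists>z\<in>fst (h x). (f x, z) \<in> near E R)"
proof -
  define r where "r = {(x, (Q, j)) | x Q j. x \<in> X \<and> Q \<in> P \<and> j < m \<and> (\<exists>z\<in>Q. (f x, z) \<in> near E R)}"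
  have finQ: "finite Q" if "Q \<in> P" for Q using P(2)[OF that] n by (metis card.infinite not_one_le_zero)
  have PY: "\<Union>P = Y" using partition_onD1[OF P(1)] by simp
  have thick: "finite (thicken E R B)" "thicken E R B \<subseteq> Y" if "finite B" "B \<subseteq> Y" for B
    using card_thicken_le[OF E(1) deg that] thicken_closed[OF E(1) that(2)] by blast+
  have r_iff: "(x, Q, j) \<in> r \<longleftrightarrow> x \<in> X \<and> Q \<in> P \<and> j < m \<and> (\<exists>z\<in>Q. (f x, z) \<in> near E R)" for x Q j
    by (simp add: r_def)
  have image: "r `` U = {Q \<in> P. Q \<inter> thicken E R (f ` U) \<noteq> {}} \<times> {..<m}" if "U \<subseteq> X" for U
  proof -
    have "(Q, j) \<in> r `` U \<longleftrightarrow> Q \<in> P \<and> j < m \<and> (\<exists>z\<in>Q. \<exists>x\<in>U. (f x, z) \<in> near E R)" for Q j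
      unfolding Image_iff r_iff using that by blast
    moreover have "(Q, j) \<in> {Q \<in> P. Q \<inter> thicken E R (f ` U) \<noteq> {}} \<times> {..<m} \<longleftrightarrow>
        Q \<in> P \<and> j < m \<and> (\<exists>z\<in>Q. \<exists>x\<in>U. (f x, z) \<in> near E R)" for Q j
      by (auto simp: in_thicken_iff disjoint_iff)
    ultimately show ?thesis by (simp only: set_eq_iff split_paired_All simp_thms)
  qed
  have preimage: "r\<inverse> `` J = f -` (thicken E R (\<Union>(fst ` J))) \<inter> X" if J: "J \<subseteq> P \<times> {..<m}" for J
  proof -
    have "x \<in> r\<inverse> `` J \<longleftrightarrow> x \<in> X \<and> (\<exists>p\<in>J. \<exists>z\<in>fst p. (z, f x) \<in> near E R)" for x
    proof -
      have "(x, p) \<in> r \<longleftrightarrow> x \<in> X \<and> (\<exists>z\<in>fst p. (z, f x) \<in> near E R)" if "p \<in> J" for p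
      proof -
        have "fst p \<in> P" "snd p < m" using J that by auto
        moreover have "(f x, z) \<in> near E R \<longleftrightarrow> (z, f x) \<in> near E R" for z
          using near_sym[OF E(2)] by blast
        ultimately show ?thesis using r_iff[of x "fst p" "snd p"] by simp
      qed
      then show ?thesis by blast
    qed
    moreover have "x \<in> f -` (thicken E R (\<Union>(fst ` J))) \<inter> X \<longleftrightarrow>
        x \<in> X \<and> (\<exists>p\<in>J. \<exists>z\<in>fst p. (z, f x) \<in> near E R)" for x
      by (auto simp: in_thicken_iff)
    ultimately show ?thesis by (simp only: set_eq_iff simp_thms)
  qed
  have touching: "finite {Q \<in> P. Q \<inter> B \<noteq> {}}" if "finite B" for B
  proof -
    have "\<exists>Q'. {Q \<in> P. y \<in> Q} \<subseteq> {Q'}" for y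
      using partition_onD2[OF P(1)] unfolding disjoint_def by blast
    then have "finite {Q \<in> P. y \<in> Q}" for y by (meson finite.emptyI finite.insertI finite_subset)
    then have "finite (\<Union>y\<in>B. {Q \<in> P. y \<in> Q})" using that by blast
    then show ?thesis by (rule rev_finite_subset) blast
  qed
  have fU: "f ` U \<subseteq> Y" if "U \<subseteq> X" for U using f that by blast
  have "\<exists>h. bij_betw h X (P \<times> {..<m}) \<and> (\<forall>x\<in>X. (x, h x) \<in> r)"
  proof (rule perfect_matching)
    show "r \<subseteq> X \<times> (P \<times> {..<m})" by (auto simp: r_def)
    show "finite (r `` {x})" if "x \<in> X" for x
      using image[of "{x}"] touching[OF thick(1)[of "f ` {x}"]] fU[of "{x}"] that by simp
    show "finite (r\<inverse> `` {p})" if "p \<in> P \<times> {..<m}" for p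
    proof -
      have p: "fst p \<in> P" "{p} \<subseteq> P \<times> {..<m}" using that by auto
      then have "finite (fst p)" "fst p \<subseteq> Y" using finQ PY by blast+
      then show ?thesis unfolding preimage[OF p(2)] using thick by (intro fin_pre) auto
    qed
    show "hall_condition X r"
      unfolding hall_condition_def
    proof (intro allI impI)
      fix U assume U: "finite U \<and> U \<subseteq> X"
      define \<Q> where "\<Q> = {Q \<in> P. Q \<inter> thicken E R (f ` U) \<noteq> {}}"
      have fin: "finite (f ` U)" "f ` U \<subseteq> Y" using U fU by auto
      have fin\<Q>: "finite \<Q>" unfolding \<Q>_def using touching thick(1)[OF fin] by blast
      have "thicken E R (f ` U) \<subseteq> \<Union>\<Q>" using thick(2)[OF fin] PY unfolding \<Q>_def by blast
      then have cover: "card (thicken E R (f ` U)) \<le> n * card \<Q>"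
        using P(2) finQ fin\<Q> by (intro card_le_times_card_of_cover) (auto simp: \<Q>_def)
      have "U \<subseteq> f -` (f ` U) \<inter> X" using U by blast
      then have "n * card U \<le> n * card (f -` (f ` U) \<inter> X)"
        using fin_pre[OF fin] by (intro mult_le_mono2 card_mono)
      also have "\<dots> \<le> m * card (thicken E R (f ` U))" using R1[OF fin] .
      also have "\<dots> \<le> m * (n * card \<Q>)" using cover by (rule mult_le_mono2)
      finally have "card U \<le> m * card \<Q>" using n by (simp add: mult.left_commute)
      then show "card U \<le> card (r `` U)"
        using image[of U] U by (simp add: \<Q>_def[symmetric] card_cartesian_product mult.commute)
    qed
    show "hall_condition (P \<times> {..<m}) (r\<inverse>)"
      unfolding hall_condition_def
    proof (intro allI impI)
      fix J assume J: "finite J \<and> J \<subseteq> P \<times> {..<m}"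
      define \<Q> where "\<Q> = fst ` J"
      have \<Q>: "finite \<Q>" "\<Q> \<subseteq> P" using J by (auto simp: \<Q>_def)
      have U: "finite (\<Union>\<Q>)" "\<Union>\<Q> \<subseteq> Y" using \<Q> finQ PY by blast+
      have "disjoint \<Q>" using partition_onD2[OF P(1)] \<Q>(2) by (rule pairwise_subset)
      then have "card (\<Union>\<Q>) = sum card \<Q>"
        using \<Q> finQ by (intro card_Union_disjoint) auto
      then have card: "card (\<Union>\<Q>) = n * card \<Q>" using P(2) \<Q>(2) by (simp add: subset_iff)
      have "J \<subseteq> \<Q> \<times> {..<m}" using J by (force simp: \<Q>_def)
      then have "card J \<le> card (\<Q> \<times> {..<m})" using \<Q>(1) by (intro card_mono) auto
      then have "n * card J \<le> m * card (\<Union>\<Q>)"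
        unfolding card using mult_le_mono2[of "card J" "card \<Q> * m" n]
        by (simp add: card_cartesian_product mult_ac)
      also have "\<dots> \<le> n * card (f -` (thicken E R (\<Union>\<Q>)) \<inter> X)" using R2[OF U] .
      finally show "card J \<le> card (r\<inverse> `` J)"
        using preimage[of J] J n by (simp add: \<Q>_def)
    qed
  qed
  then show ?thesis by (force simp: r_def)
qed

theorem partitions_imp_bijection:
  fixes m n :: nat
  assumes PX: "partition_on X PX" "\<And>P. P \<in> PX \<Longrightarrow> card P = m"
    and PY: "partition_on Y PY" "\<And>Q. Q \<in> PY \<Longrightarrow> card Q = n"
    and \<psi>: "bij_betw \<psi> PX PY" and mn: "m \<ge> 1" "n \<ge> 1"
  shows "\<exists>h. bij_betw h (X \<times> {..<n}) (Y \<times> {..<m}) \<and>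
    (\<forall>P\<in>PX. \<forall>x\<in>P. \<forall>i<n. fst (h (x, i)) \<in> \<psi> P)"
proof -
  have \<psi>Y: "\<psi> P \<in> PY" if "P \<in> PX" for P using bij_betwE[OF \<psi>] that by blast
  have "\<exists>e. bij_betw e (P \<times> {..<n}) (\<psi> P \<times> {..<m})" if "P \<in> PX" for P
  proof -
    have "card P = m" "card (\<psi> P) = n" using PX(2) PY(2) \<psi>Y that by auto
    moreover from this have "finite P" "finite (\<psi> P)" using mn by (auto intro: card_ge_0_finite)
    ultimately show ?thesis
      by (intro finite_same_card_bij) (auto simp: card_cartesian_product)
  qed
  then obtain e where e: "\<And>P. P \<in> PX \<Longrightarrow> bij_betw (e P) (P \<times> {..<n}) (\<psi> P \<times> {..<m})" by metis
  define piece where "piece x = (THE P. P \<in> PX \<and> x \<in> P)" for x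
  have piece: "piece x = P" if "P \<in> PX" "x \<in> P" for P x
    unfolding piece_def using that partition_onD2[OF PX(1)]
    by (intro the_equality) (auto simp: disjoint_def)
  define h where "h p = e (piece (fst p)) p" for p
  have h: "bij_betw h (P \<times> {..<n}) (\<psi> P \<times> {..<m})" if "P \<in> PX" for P
    using e[OF that] by (rule bij_betw_cong[THEN iffD1, rotated]) (use piece[OF that] in \<open>auto simp: h_def\<close>)
  have "bij_betw h (\<Union>P\<in>PX. P \<times> {..<n}) (\<Union>P\<in>PX. \<psi> P \<times> {..<m})"
  proof (rule bij_betw_UNION_disjoint)
    have "\<psi> P \<inter> \<psi> Q = {}" if "P \<in> PX" "Q \<in> PX" "P \<noteq> Q" for P Q
      using partition_onD2[OF PY(1)] \<psi>Y that bij_betw_imp_inj_on[OF \<psi>]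
      unfolding disjoint_def inj_on_def by metis
    then show "disjoint_family_on (\<lambda>P. \<psi> P \<times> {..<m}) PX"
      unfolding disjoint_family_on_def by blast
  qed (rule h)
  moreover have "(\<Union>P\<in>PX. P \<times> {..<n}) = X \<times> {..<n}" using partition_onD1[OF PX(1)] by blast
  moreover have "(\<Union>P\<in>PX. \<psi> P \<times> {..<m}) = Y \<times> {..<m}"
    using partition_onD1[OF PY(1)] bij_betw_imp_surj_on[OF \<psi>] by blast
  moreover have "fst (h (x, i)) \<in> \<psi> P" if "P \<in> PX" "x \<in> P" "i < n" for P x i
  proof -
    have "(x, i) \<in> P \<times> {..<n}" using that by simp
    then have "h (x, i) \<in> \<psi> P \<times> {..<m}" using bij_betwE[OF h[OF that(1)]] by blast
    then show ?thesis by (simp add: mem_Times_iff)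
  qed
  ultimately show ?thesis by metis
qed

theorem proposition4p2:
  fixes m n :: nat
    and X :: "'a set" and E\<^sub>X :: "'a rel"
    and Y :: "'b set" and E\<^sub>Y :: "'b rel"
    and E\<^sub>Z :: "nat rel"
    and f :: "'a \<Rightarrow> 'b"
  assumes "m \<ge> 1" and "n \<ge> 1"
    and "connected_graph X E\<^sub>X" and "bounded_degree X E\<^sub>X"
    and "connected_graph Y E\<^sub>Y" and "bounded_degree Y E\<^sub>Y"
    and "infinite X \<or> coprime m n"
    and "connected_graph {..<m} E\<^sub>Z"
    and "quasi_isometry X (gdist E\<^sub>X) Y (gdist E\<^sub>Y) f"
  shows
    "(quasi_to_one (real m / real n) X Y E\<^sub>Y f
      \<longleftrightarrow>
      (\<exists>h. bij_betw h (X \<times> {..<n}) (Y \<times> {..<m}) \<and>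
           at_bounded_distance (X \<times> {..<n}) (gdist (box_product Y E\<^sub>Y {..<m} E\<^sub>Z))
             ((\<lambda>y. (y, 0)) \<circ> f \<circ> fst) h))
     \<and>
     (quasi_to_one (real m / real n) X Y E\<^sub>Y f
      \<longleftrightarrow>
      (\<exists>P\<^sub>X P\<^sub>Y \<psi>.
           partition_on X P\<^sub>X \<and> uniformly_bounded (gdist E\<^sub>X) P\<^sub>X \<and> (\<forall>P\<in>P\<^sub>X. card P = m) \<and>
           partition_on Y P\<^sub>Y \<and> uniformly_bounded (gdist E\<^sub>Y) P\<^sub>Y \<and> (\<forall>Q\<in>P\<^sub>Y. card Q = n) \<and>
           bij_betw \<psi> P\<^sub>X P\<^sub>Y \<and>
           (\<exists>g. g \<in> X \<rightarrow> Y \<and> at_bounded_distance X (gdist E\<^sub>Y) f g \<and> (\<forall>P\<in>P\<^sub>X. g ` P \<subseteq> \<psi> P))))"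
    (is "(?i \<longleftrightarrow> ?ii) \<and> (?i \<longleftrightarrow> ?iii)")
proof -
  note mn = assms(1,2) and X = assms(3) and Y = assms(5) and Z = assms(8)
  let ?B = "box_product Y E\<^sub>Y {..<m} E\<^sub>Z"
  have EY: "E\<^sub>Y \<subseteq> Y \<times> Y" "sym E\<^sub>Y" using Y by (auto simp: connected_graph_def simple_graph_def)
  obtain D where deg: "\<forall>y\<in>Y. finite (E\<^sub>Y `` {y}) \<and> card (E\<^sub>Y `` {y}) \<le> D"
    using assms(6) by (auto simp: bounded_degree_def)
  note box = connected_graph_box_product[OF Y Z]
  obtain C K where C: "C \<ge> 1" and f: "f \<in> X \<rightarrow> Y"
    and expand: "\<And>x x'. x \<in> X \<Longrightarrow> x' \<in> X \<Longrightarrow> 1 / C * gdist E\<^sub>X x x' - K \<le> gdist E\<^sub>Y (f x) (f x')"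
    and dense: "\<And>y. y \<in> Y \<Longrightarrow> \<exists>x\<in>X. gdist E\<^sub>Y y (f x) \<le> K"
    using assms(9) unfolding quasi_isometry_def by blast
  have dense': "\<exists>x\<in>X. (y, f x) \<in> near E\<^sub>Y (nat \<lceil>K\<rceil>)" if "y \<in> Y" for y
    using dense[OF that] gdist_le_imp_near[OF Y that] f by blast
  have expand': "gdist E\<^sub>X x x' \<le> C * (real k + K)"
    if "x \<in> X" "x' \<in> X" "(f x, f x') \<in> near E\<^sub>Y k" for x x' k
  proof -
    have "gdist E\<^sub>Y (f x) (f x') \<le> real k" using gdist_le_iff[OF Y] f that by blast
    then have "1 / C * gdist E\<^sub>X x x' \<le> real k + K" using expand[OF that(1,2)] by linarith
    then show ?thesis using C by (simp add: field_simps)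
  qed

  have "?i" if ii: "?ii"
  proof -
    obtain h where h: "bij_betw h (X \<times> {..<n}) (Y \<times> {..<m})" and
      bd: "at_bounded_distance (X \<times> {..<n}) (gdist ?B) ((\<lambda>y. (y, 0)) \<circ> f \<circ> fst) h"
      using ii by blast
    have "(\<lambda>y. (y, 0)) \<circ> f \<circ> fst \<in> X \<times> {..<n} \<rightarrow> Y \<times> {..<m}" using f mn by auto
    moreover have "h \<in> X \<times> {..<n} \<rightarrow> Y \<times> {..<m}" using bij_betwE[OF h] by blast
    ultimately obtain k where k: "\<forall>p\<in>X \<times> {..<n}. (((\<lambda>y. (y, 0)) \<circ> f \<circ> fst) p, h p) \<in> near ?B k"
      using at_bounded_distance_iff[OF box] bd by blast
    have "(f x, fst (h (x, i))) \<in> near E\<^sub>Y k" if "x \<in> X" "i < n" for x i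
    proof -
      have "((f x, 0), h (x, i)) \<in> near ?B k" using bspec[OF k, of "(x, i)"] that by simp
      then show ?thesis using box_product_near_fst by fastforce
    qed
    then show ?i using bijection_imp_quasi_to_one[OF EY deg mn h] by blast
  qed
  moreover have "?iii" if i: "?i"
  proof -
    obtain R where R: "\<And>B. finite B \<Longrightarrow> B \<subseteq> Y \<Longrightarrow>
          n * card (f -` B \<inter> X) \<le> m * card (thicken E\<^sub>Y R B)"
      "\<And>B. finite B \<Longrightarrow> B \<subseteq> Y \<Longrightarrow> m * card B \<le> n * card (f -` (thicken E\<^sub>Y R B) \<inter> X)"
      using quasi_to_one_imp_thickened_bounds[OF EY deg mn f dense' i] by blast
    obtain c where fin_pre: "\<And>A. finite A \<Longrightarrow> A \<subseteq> Y \<Longrightarrow> finite (f -` A \<inter> X)"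
      and c: "\<And>A. finite A \<Longrightarrow> A \<subseteq> Y \<Longrightarrow>
        m * card A \<le> n * card (f -` A \<inter> X) + c * card (vertex_boundary E\<^sub>Y A)"
      "\<And>A. finite A \<Longrightarrow> A \<subseteq> Y \<Longrightarrow>
        n * card (f -` A \<inter> X) \<le> m * card A + c * card (vertex_boundary E\<^sub>Y A)"
      using quasi_to_one_natE[OF i mn(2)] by metis
    \<comment> \<open>The whole of \<open>Y\<close> has empty boundary, so (i) is an equality there.\<close>
    have "n dvd card Y" if fin: "finite Y"
    proof -
      have X': "f -` Y \<inter> X = X" using f by blast
      then have "finite X" using fin_pre[OF fin] by simp
      then have "coprime n m" using assms(7) by (simp add: coprime_commute)
      moreover have "vertex_boundary E\<^sub>Y Y = {}" using EY by (auto simp: vertex_boundary_def)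
      then have "m * card Y = n * card X" using c(1,2)[OF fin] X' by simp
      then have "n dvd m * card Y" by simp
      ultimately show ?thesis by (simp add: coprime_dvd_mult_right_iff)
    qed
    then obtain P\<^sub>Y l where PY: "partition_on Y P\<^sub>Y"
      and PY': "\<And>Q. Q \<in> P\<^sub>Y \<Longrightarrow> card Q = n" "\<And>Q. Q \<in> P\<^sub>Y \<Longrightarrow> Q \<times> Q \<subseteq> near E\<^sub>Y l"
      using graph_equipartition[OF Y _ mn(2)] deg by metis
    have PY_sub: "Q \<subseteq> Y" if "Q \<in> P\<^sub>Y" for Q using partition_onD1[OF PY] that by blast
    obtain h where h: "bij_betw h X (P\<^sub>Y \<times> {..<m})"
      and "\<And>x. x \<in> X \<Longrightarrow> \<exists>z\<in>fst (h x). (f x, z) \<in> near E\<^sub>Y R"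
      using thickened_bounds_imp_matching[OF EY deg mn(2) f fin_pre R PY PY'(1)] by blast
    then obtain g where g: "\<And>x. x \<in> X \<Longrightarrow> g x \<in> fst (h x)" "\<And>x. x \<in> X \<Longrightarrow> (f x, g x) \<in> near E\<^sub>Y R"
      by metis
    have hP: "fst (h x) \<in> P\<^sub>Y" if "x \<in> X" for x using bij_betwE[OF h] that by (metis mem_Times_iff)
    \<comment> \<open>Over \<open>Q\<close>, the bijection \<open>h\<close> takes the \<open>m\<close> values \<open>(Q, j)\<close>.\<close>
    define fib where "fib Q = {x \<in> X. fst (h x) = Q}" for Q
    have fib_card: "card (fib Q) = m" if "Q \<in> P\<^sub>Y" for Q
    proof -
      have "h ` fib Q = {Q} \<times> {..<m}"
      proof
        show "h ` fib Q \<subseteq> {Q} \<times> {..<m}" using bij_betwE[OF h] by (force simp: fib_def)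
        show "{Q} \<times> {..<m} \<subseteq> h ` fib Q"
        proof
          fix p assume p: "p \<in> {Q} \<times> {..<m}"
          then have "p \<in> h ` X" using bij_betw_imp_surj_on[OF h] that by auto
          then obtain x where "x \<in> X" "p = h x" by blast
          moreover from this have "x \<in> fib Q" using p by (simp add: fib_def mem_Times_iff)
          ultimately show "p \<in> h ` fib Q" by blast
        qed
      qed
      moreover have "inj_on h (fib Q)"
        using bij_betw_imp_inj_on[OF h] by (rule inj_on_subset) (auto simp: fib_def)
      ultimately show ?thesis using card_image by fastforce
    qed
    then have fib_ne: "fib Q \<noteq> {}" if "Q \<in> P\<^sub>Y" for Q using that mn by fastforce
    have fib_inj: "inj_on fib P\<^sub>Y"
      using fib_ne by (auto simp: inj_on_def fib_def)
    define P\<^sub>X where "P\<^sub>X = fib ` P\<^sub>Y"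
    have PX: "partition_on X P\<^sub>X"
      by (rule partition_onI) (use fib_ne hP in \<open>auto simp: P\<^sub>X_def fib_def disjnt_def\<close>)
    have \<psi>: "bij_betw (inv_into P\<^sub>Y fib) P\<^sub>X P\<^sub>Y"
      unfolding P\<^sub>X_def using fib_inj by (intro bij_betw_inv_into) (simp add: bij_betw_def)
    have "g ` P \<subseteq> inv_into P\<^sub>Y fib P" if P: "P \<in> P\<^sub>X" for P
    proof -
      obtain Q where "Q \<in> P\<^sub>Y" "P = fib Q" using P by (auto simp: P\<^sub>X_def)
      then show ?thesis using g(1) inv_into_f_f[OF fib_inj] by (auto simp: fib_def)
    qed
    moreover have gY: "g \<in> X \<rightarrow> Y" using g(1) hP PY_sub by blast
    moreover have "at_bounded_distance X (gdist E\<^sub>Y) f g"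
      using at_bounded_distance_iff[OF Y f gY] g(2) by blast
    moreover have "uniformly_bounded (gdist E\<^sub>Y) P\<^sub>Y"
      using uniformly_bounded_iff[OF Y PY_sub] PY'(2) by blast
    moreover have "uniformly_bounded (gdist E\<^sub>X) P\<^sub>X"
    proof -
      have "gdist E\<^sub>X x x' \<le> C * (real (R + l + R) + K)" if P: "P \<in> P\<^sub>X" "x \<in> P" "x' \<in> P" for P x x'
      proof -
        obtain Q where Q: "Q \<in> P\<^sub>Y" "x \<in> X" "x' \<in> X" "fst (h x) = Q" "fst (h x') = Q"
          using P by (auto simp: P\<^sub>X_def fib_def)
        then have "(g x, g x') \<in> near E\<^sub>Y l" using g(1)[of x] g(1)[of x'] PY'(2)[OF Q(1)] by blast
        then have "(f x, f x') \<in> near E\<^sub>Y (R + l + R)"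
          using g(2)[OF Q(2)] near_sym[OF EY(2) g(2)[OF Q(3)]] by (blast intro: relpow_trans)
        then show ?thesis using expand'[OF Q(2,3)] by blast
      qed
      then show ?thesis unfolding uniformly_bounded_def by blast
    qed
    moreover have "\<forall>P\<in>P\<^sub>X. card P = m" using fib_card by (auto simp: P\<^sub>X_def)
    ultimately show ?iii using PX PY PY'(1) \<psi> by blast
  qed
  moreover have "?ii" if iii: "?iii"
    using iii
  proof (elim exE conjE)
    fix P\<^sub>X P\<^sub>Y \<psi> g
    assume PX: "partition_on X P\<^sub>X" "\<forall>P\<in>P\<^sub>X. card P = m"
      and PY: "partition_on Y P\<^sub>Y" "\<forall>Q\<in>P\<^sub>Y. card Q = n"
      and ub: "uniformly_bounded (gdist E\<^sub>Y) P\<^sub>Y" and \<psi>: "bij_betw \<psi> P\<^sub>X P\<^sub>Y"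
      and g: "g \<in> X \<rightarrow> Y" "at_bounded_distance X (gdist E\<^sub>Y) f g" "\<forall>P\<in>P\<^sub>X. g ` P \<subseteq> \<psi> P"
    have "Q \<subseteq> Y" if "Q \<in> P\<^sub>Y" for Q using partition_onD1[OF PY(1)] that by blast
    then obtain l where l: "\<And>Q. Q \<in> P\<^sub>Y \<Longrightarrow> Q \<times> Q \<subseteq> near E\<^sub>Y l"
      using uniformly_bounded_iff[OF Y] ub by metis
    obtain k where k: "\<And>x. x \<in> X \<Longrightarrow> (f x, g x) \<in> near E\<^sub>Y k"
      using at_bounded_distance_iff[OF Y f g(1)] g(2) by blast
    obtain d where d: "{..<m} \<times> {..<m} \<subseteq> near E\<^sub>Z d"
      using finite_connected_graph_bounded[OF Z] by blast
    have "card P = m" if "P \<in> P\<^sub>X" for P using PX(2) that by blast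
    moreover have "card Q = n" if "Q \<in> P\<^sub>Y" for Q using PY(2) that by blast
    ultimately obtain h where h: "bij_betw h (X \<times> {..<n}) (Y \<times> {..<m})"
      and h\<psi>: "\<forall>P\<in>P\<^sub>X. \<forall>x\<in>P. \<forall>i<n. fst (h (x, i)) \<in> \<psi> P"
      using partitions_imp_bijection[OF PX(1) _ PY(1) _ \<psi> mn] by metis
    have hY: "h p \<in> Y \<times> {..<m}" if "p \<in> X \<times> {..<n}" for p using bij_betwE[OF h] that by blast
    have "(((\<lambda>y. (y, 0)) \<circ> f \<circ> fst) p, h p) \<in> near ?B (k + l + d)" if p: "p \<in> X \<times> {..<n}" for p
    proof -
      obtain x i where xi: "p = (x, i)" "x \<in> X" "i < n" using p by auto
      obtain P where P: "P \<in> P\<^sub>X" "x \<in> P" using partition_onD1[OF PX(1)] xi by blast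
      have "(g x, fst (h p)) \<in> near E\<^sub>Y l"
      proof -
        have "g x \<in> \<psi> P" "fst (h p) \<in> \<psi> P" using P g(3) h\<psi> xi by auto
        moreover have "\<psi> P \<times> \<psi> P \<subseteq> near E\<^sub>Y l" using l bij_betwE[OF \<psi>] P(1) by blast
        ultimately show ?thesis by blast
      qed
      then have "(f x, fst (h p)) \<in> near E\<^sub>Y (k + l)" using k[OF xi(2)] by (blast intro: relpow_trans)
      moreover have "(0, snd (h p)) \<in> near E\<^sub>Z d" using d hY[OF p] mn by (auto simp: mem_Times_iff)
      ultimately have "((f x, 0), (fst (h p), snd (h p))) \<in> near ?B (k + l + d)"
        using hY[OF p] mn by (intro box_product_near) (auto simp: mem_Times_iff)
      then show ?thesis using xi(1) by simp
    qed
    moreover have "(\<lambda>y. (y, 0)) \<circ> f \<circ> fst \<in> X \<times> {..<n} \<rightarrow> Y \<times> {..<m}" using f mn by auto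
    moreover have "h \<in> X \<times> {..<n} \<rightarrow> Y \<times> {..<m}" using hY by blast
    ultimately have "at_bounded_distance (X \<times> {..<n}) (gdist ?B) ((\<lambda>y. (y, 0)) \<circ> f \<circ> fst) h"
      using at_bounded_distance_iff[OF box] by blast
    then show ?ii using h by blast
  qed
  ultimately show ?thesis by blast
qed

end
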